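(* For each fixed integer $k \ge 1$, the class of $k$-base-orderable matroids is complete.
   Context: All matroids are finite. For a positive integer $k$, a $k$-exchange-ordering for a pair of bases $B_1$ and $B_2$ of a matroid $M$ is a bijection $\sigma : B_1\to B_2$ such that, for every $X\subseteq B_1$ with $|X|\le k$, both $(B_1-X)\cup\sigma(X)$ and $(B_2-\sigma(X))\cup X$ are bases of $M$. A matroid is $k$-base-orderable if each pair of its bases has a $k$-exchange-ordering. A class of matroids is a collection of matroids closed under isomorphism. It is complete if it is closed under the operations of minors, duals, direct sums, truncations, and induction by directed graphs. Truncation: for a matroid $M$ with rank function $r$ and $e\notin E(M)$, the free extension $M+_{E(M)}e$ is the matroid on $E(M)\cup\{e\}$ whose rank function satisfies, for $X\subseteq E(M)$, $r_{M+_{E(M)}e}(X)=r(X)$ and $r_{M+_{E(M)}e}(X\cup\{e\})=\min\{r(X)+1,\ r(M)\}$; the truncation of $M$ is $(M+_{E(M)}e)/e$. Induction by directed graphs: let $\Gamma$ be a (finite) directed graph and $M$ a matroid with $E(M)\subseteq V(\Gamma)$. The induced matroid $\Gamma(M)$ is the matroid on $V(\Gamma)$ in which a subset of $V(\Gamma)$ is independent if and only if it can be linked to an independent set of $M$; here $W$ is linked to $Z$ if $|W|=|Z|$ and there are $|W|$ pairwise vertex-disjoint directed paths (paths with a single vertex allowed) whose set of initial vertices is $W$ and whose set of terminal vertices is $Z$. *)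

theory Defs
  imports Main "HOL-Library.Disjoint_Sets" "Graph_Theory.Pair_Digraph"
begin

section \<open>Finite matroids\<close>

text \<open>A value of type \<open>'a pre_matroid\<close> is only a pair of a ground set and a family of sets;
  the matroid axioms are imposed by the predicate \<open>matroid\<close>.\<close>

record 'a pre_matroid =
  ground :: "'a set"
  indeps :: "'a set set"

definition matroid :: "'a pre_matroid \<Rightarrow> bool" where
  "matroid M \<longleftrightarrow>
     finite (ground M) \<and>
     (\<forall>I\<in>indeps M. I \<subseteq> ground M) \<and>
     {} \<in> indeps M \<and>
     (\<forall>I\<in>indeps M. \<forall>J. J \<subseteq> I \<longrightarrow> J \<in> indeps M) \<and>
     (\<forall>I\<in>indeps M. \<forall>J\<in>indeps M. card I < card J \<longrightarrow> (\<exists>x\<in>J - I. insert x I \<in> indeps M))"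

definition bases :: "'a pre_matroid \<Rightarrow> 'a set set" where
  "bases M = {B \<in> indeps M. \<forall>I\<in>indeps M. B \<subseteq> I \<longrightarrow> I = B}"

definition rank :: "'a pre_matroid \<Rightarrow> 'a set \<Rightarrow> nat" where
  "rank M X = Max {card I | I. I \<in> indeps M \<and> I \<subseteq> X}"

definition isomorphic :: "'a pre_matroid \<Rightarrow> 'b pre_matroid \<Rightarrow> bool" where
  "isomorphic M N \<longleftrightarrow>
     (\<exists>f. bij_betw f (ground M) (ground N) \<and>
          (\<forall>X. X \<subseteq> ground M \<longrightarrow> (X \<in> indeps M \<longleftrightarrow> f ` X \<in> indeps N)))"


section \<open>Base-orderability\<close>

definition k_exchange_ordering ::
    "nat \<Rightarrow> 'a pre_matroid \<Rightarrow> 'a set \<Rightarrow> 'a set \<Rightarrow> ('a \<Rightarrow> 'a) \<Rightarrow> bool" where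
  "k_exchange_ordering k M B1 B2 \<sigma> \<longleftrightarrow>
     bij_betw \<sigma> B1 B2 \<and>
     (\<forall>X. X \<subseteq> B1 \<and> card X \<le> k \<longrightarrow>
        (B1 - X) \<union> \<sigma> ` X \<in> bases M \<and> (B2 - \<sigma> ` X) \<union> X \<in> bases M)"

definition k_base_orderable :: "nat \<Rightarrow> 'a pre_matroid \<Rightarrow> bool" where
  "k_base_orderable k M \<longleftrightarrow>
     matroid M \<and>
     (\<forall>B1\<in>bases M. \<forall>B2\<in>bases M. \<exists>\<sigma>. k_exchange_ordering k M B1 B2 \<sigma>)"


section \<open>Matroid operations\<close>

definition dual :: "'a pre_matroid \<Rightarrow> 'a pre_matroid" where
  "dual M = \<lparr>ground = ground M, indeps = {I. \<exists>B\<in>bases M. I \<subseteq> ground M - B}\<rparr>"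

definition delete :: "'a pre_matroid \<Rightarrow> 'a set \<Rightarrow> 'a pre_matroid" where
  "delete M D = \<lparr>ground = ground M - D, indeps = {I \<in> indeps M. I \<inter> D = {}}\<rparr>"

definition contract :: "'a pre_matroid \<Rightarrow> 'a set \<Rightarrow> 'a pre_matroid" where
  "contract M C = dual (delete (dual M) C)"

definition minor :: "'a pre_matroid \<Rightarrow> 'a pre_matroid \<Rightarrow> bool" where
  "minor N M \<longleftrightarrow>
     (\<exists>C D. C \<subseteq> ground M \<and> D \<subseteq> ground M \<and> C \<inter> D = {} \<and> N = delete (contract M C) D)"

text \<open>Only used for matroids on disjoint ground sets.\<close>

definition direct_sum :: "'a pre_matroid \<Rightarrow> 'a pre_matroid \<Rightarrow> 'a pre_matroid" where
  "direct_sum M N =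
     \<lparr>ground = ground M \<union> ground N, indeps = {I \<union> J | I J. I \<in> indeps M \<and> J \<in> indeps N}\<rparr>"

definition matroid_of_rank :: "'a set \<Rightarrow> ('a set \<Rightarrow> nat) \<Rightarrow> 'a pre_matroid" where
  "matroid_of_rank E r = \<lparr>ground = E, indeps = {I. I \<subseteq> E \<and> r I = card I}\<rparr>"

text \<open>Only used for \<open>e\<close> outside the ground set of \<open>M\<close>.\<close>

definition free_extension :: "'a pre_matroid \<Rightarrow> 'a \<Rightarrow> 'a pre_matroid" where
  "free_extension M e =
     matroid_of_rank (insert e (ground M))
       (\<lambda>Y. if e \<in> Y then min (rank M (Y - {e}) + 1) (rank M (ground M)) else rank M Y)"

definition truncation :: "'a pre_matroid \<Rightarrow> 'a \<Rightarrow> 'a pre_matroid" where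
  "truncation M e = contract (free_extension M e) {e}"


section \<open>Induction by directed graphs\<close>

text \<open>A path is a triple of its initial vertex, its list of arcs (empty for a path with a single
  vertex) and its terminal vertex.  Digraphs may have loops; parallel arcs are not represented,
  since they have no influence on which sets are linked.\<close>

definition path_verts :: "'a pair_pre_digraph \<Rightarrow> 'a \<times> ('a \<times> 'a) list \<times> 'a \<Rightarrow> 'a set" where
  "path_verts \<Gamma> = (\<lambda>(u, p, v). set (pre_digraph.awalk_verts (with_proj \<Gamma>) u p))"

definition linked :: "'a pair_pre_digraph \<Rightarrow> 'a set \<Rightarrow> 'a set \<Rightarrow> bool" where
  "linked \<Gamma> W Z \<longleftrightarrow>
     card W = card Z \<and>
     (\<exists>P. finite P \<and> card P = card W \<and>
          (\<forall>(u, p, v)\<in>P. pre_digraph.apath (with_proj \<Gamma>) u p v) \<and>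
          disjoint_family_on (path_verts \<Gamma>) P \<and>
          (\<lambda>(u, p, v). u) ` P = W \<and>
          (\<lambda>(u, p, v). v) ` P = Z)"

definition induced_matroid :: "'a pair_pre_digraph \<Rightarrow> 'a pre_matroid \<Rightarrow> 'a pre_matroid" where
  "induced_matroid \<Gamma> M =
     \<lparr>ground = pverts \<Gamma>,
      indeps = {W. W \<subseteq> pverts \<Gamma> \<and> (\<exists>Z\<in>indeps M. linked \<Gamma> W Z)}\<rparr>"


section \<open>Complete classes\<close>

definition matroid_class :: "'a pre_matroid set \<Rightarrow> bool" where
  "matroid_class \<C> \<longleftrightarrow>
     (\<forall>M\<in>\<C>. matroid M) \<and>
     (\<forall>M\<in>\<C>. \<forall>N. matroid N \<and> isomorphic M N \<longrightarrow> N \<in> \<C>)"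

text \<open>Up to isomorphism, arbitrary finite ground sets, fresh elements and disjoint copies exist
  within \<open>'a\<close> as soon as \<open>'a\<close> is infinite.\<close>

definition complete_class :: "'a pre_matroid set \<Rightarrow> bool" where
  "complete_class \<C> \<longleftrightarrow>
     matroid_class \<C> \<and>
     (\<forall>M\<in>\<C>. \<forall>N. minor N M \<longrightarrow> N \<in> \<C>) \<and>
     (\<forall>M\<in>\<C>. dual M \<in> \<C>) \<and>
     (\<forall>M\<in>\<C>. \<forall>N\<in>\<C>. ground M \<inter> ground N = {} \<longrightarrow> direct_sum M N \<in> \<C>) \<and>
     (\<forall>M\<in>\<C>. \<forall>e. e \<notin> ground M \<longrightarrow> truncation M e \<in> \<C>) \<and>
     (\<forall>M\<in>\<C>. \<forall>\<Gamma>. pair_fin_digraph \<Gamma> \<and> ground M \<subseteq> pverts \<Gamma> \<longrightarrow> induced_matroid \<Gamma> M \<in> \<C>)"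

end

theory Submission
  imports Defs
begin

text \<open>
  A \<open>k\<close>-exchange-ordering with \<open>k \<ge> 1\<close> fixes the common elements of the two bases
  (\<open>exchange_ordering_fixes_common\<close>), so it amounts to a bijection between the two set differences
  with the same exchange property (\<open>exchange_ordering_iff_strict\<close>). Passing to complements, or adding
  the same elements to both bases, does not affect such a bijection. This gives closure under
  duals and deletions, hence under contractions and all minors. Orderings of the
  summands glue to an ordering of a direct sum.

  Truncation and induction by directed graphs are both reduced to one construction, the principal
  extension, in which a new element \<open>e\<close> is placed freely in the span of a set \<open>F\<close>. The core of the
  proof is that it preserves \<open>k\<close>-base-orderability (\<open>k_base_orderable_principal_extension\<close>). The
  hard case is that of two bases that both contain \<open>e\<close> and in which \<open>e\<close> stands for different elements
  \<open>f1\<close> and \<open>f2\<close> of \<open>F\<close>. An exchange that would have to move both of these can have \<open>k + 1\<close> elements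
  in the old matroid. Two exchanges of at most \<open>k\<close> elements are available instead, and together with
  an argument in rank two they leave a choice between \<open>f1\<close> and \<open>f2\<close> as the element for which \<open>e\<close>
  stands afterwards (\<open>exchange_ordering_principal_both\<close>).

  The truncation is the contraction of \<open>e\<close> in the principal extension with \<open>F\<close> the whole ground set.
  Repeated principal extension followed by deletion of the old elements is induction by a
  bipartite graph (\<open>k_base_orderable_bipartite_induction\<close>). Composing matchings directly with an
  ordering does not suffice for this step: the result need not fix the common elements of
  two bases, and repairing that can exceed the bound \<open>k\<close>. Finally, following the arcs of a
  linking turns a linking of \<open>W\<close> to \<open>Z\<close> into a matching between the complements of \<open>Z\<close> and \<open>W\<close>, and
  conversely (\<open>successor_of_linkage\<close>, \<open>linkage_of_successor\<close>). Therefore induction by a directed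
  graph is the dual of bipartite induction applied to the dual matroid.
\<close>

section \<open>Bases of finite matroids\<close>

lemma finite_ground: "matroid M \<Longrightarrow> finite (ground M)"
  by (simp add: matroid_def)

lemma indep_subset_ground: "matroid M \<Longrightarrow> I \<in> indeps M \<Longrightarrow> I \<subseteq> ground M"
  by (simp add: matroid_def)

lemma indep_finite: "matroid M \<Longrightarrow> I \<in> indeps M \<Longrightarrow> finite I"
  by (meson finite_ground finite_subset indep_subset_ground)

lemma finite_indeps:
  assumes "matroid M"
  shows "finite (indeps M)"
proof (rule finite_subset)
  show "indeps M \<subseteq> Pow (ground M)" using assms indep_subset_ground by blast
  show "finite (Pow (ground M))" using assms finite_ground by simp
qed

lemma indep_empty: "matroid M \<Longrightarrow> {} \<in> indeps M"
  by (simp add: matroid_def)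

lemma indep_mono: "matroid M \<Longrightarrow> I \<in> indeps M \<Longrightarrow> J \<subseteq> I \<Longrightarrow> J \<in> indeps M"
  by (simp add: matroid_def)

lemma indep_augment:
  assumes "matroid M" "I \<in> indeps M" "J \<in> indeps M" "card I < card J"
  shows "\<exists>x. x \<in> J \<and> x \<notin> I \<and> insert x I \<in> indeps M"
  using assms unfolding matroid_def by blast

lemma matroidI:
  assumes "finite (ground M)"
    and "\<And>I. I \<in> indeps M \<Longrightarrow> I \<subseteq> ground M"
    and "{} \<in> indeps M"
    and "\<And>I J. I \<in> indeps M \<Longrightarrow> J \<subseteq> I \<Longrightarrow> J \<in> indeps M"
    and "\<And>I J. I \<in> indeps M \<Longrightarrow> J \<in> indeps M \<Longrightarrow> card I < card J \<Longrightarrow>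
           \<exists>x\<in>J - I. insert x I \<in> indeps M"
  shows "matroid M"
  using assms unfolding matroid_def by blast

lemma basis_indep: "B \<in> bases M \<Longrightarrow> B \<in> indeps M"
  by (simp add: bases_def)

lemma basis_finite: "matroid M \<Longrightarrow> B \<in> bases M \<Longrightarrow> finite B"
  by (simp add: basis_indep indep_finite)

lemma basis_subset_ground: "matroid M \<Longrightarrow> B \<in> bases M \<Longrightarrow> B \<subseteq> ground M"
  by (simp add: basis_indep indep_subset_ground)

lemma card_indep_le_basis:
  assumes "matroid M" "B \<in> bases M" "I \<in> indeps M"
  shows "card I \<le> card B"
proof (rule ccontr)
  assume "\<not> card I \<le> card B"
  then obtain x where "x \<notin> B" "insert x B \<in> indeps M"
    using assms basis_indep indep_augment not_le by metis
  then show False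
    using assms(2) unfolding bases_def by blast
qed

lemma basisI_card:
  assumes "matroid M" "I \<in> indeps M" "\<And>J. J \<in> indeps M \<Longrightarrow> card J \<le> card I"
  shows "I \<in> bases M"
  using assms indep_finite[OF assms(1)] card_seteq unfolding bases_def by blast

lemma basis_iff_card:
  assumes "matroid M" "B \<in> bases M"
  shows "I \<in> bases M \<longleftrightarrow> I \<in> indeps M \<and> card I = card B"
  using assms by (metis basisI_card basis_indep card_indep_le_basis le_antisym)

lemma card_bases_eq: "matroid M \<Longrightarrow> A \<in> bases M \<Longrightarrow> B \<in> bases M \<Longrightarrow> card A = card B"
  using basis_iff_card by blast

lemma finite_has_max_card:
  assumes "finite S" "S \<noteq> {}"
  shows "\<exists>J\<in>S. \<forall>K\<in>S. card K \<le> card J"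
proof -
  have "Max (card ` S) \<in> card ` S" using assms by simp
  then obtain J where "J \<in> S" "card J = Max (card ` S)" by (metis imageE)
  moreover have "card K \<le> Max (card ` S)" if "K \<in> S" for K using assms that by simp
  ultimately show ?thesis by metis
qed

lemma extend_to_basis_within:
  assumes M: "matroid M" and I: "I \<in> indeps M" and B: "B \<in> bases M"
  obtains B' where "B' \<in> bases M" "I \<subseteq> B'" "B' \<subseteq> I \<union> B"
proof -
  let ?S = "{J \<in> indeps M. I \<subseteq> J \<and> J \<subseteq> I \<union> B}"
  have "finite ?S" using finite_indeps[OF M] by simp
  moreover have "?S \<noteq> {}" using I by auto
  ultimately obtain J where J: "J \<in> ?S" and max: "\<And>K. K \<in> ?S \<Longrightarrow> card K \<le> card J"
    using finite_has_max_card[of ?S] by blast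
  have "card J = card B"
  proof (rule ccontr)
    assume "card J \<noteq> card B"
    moreover have J': "J \<in> indeps M" using J by simp
    ultimately have "card J < card B" using card_indep_le_basis[OF M B J'] by simp
    then obtain x where x: "x \<in> B" "x \<notin> J" "insert x J \<in> indeps M"
      using indep_augment[OF M J' basis_indep[OF B]] by blast
    then have "insert x J \<in> ?S" using J by auto
    then have "card (insert x J) \<le> card J" by (rule max)
    then show False using x indep_finite[OF M J'] by simp
  qed
  then have "J \<in> bases M" using J basis_iff_card[OF M B] by blast
  then show thesis using that J by blast
qed

lemma exists_basis:
  assumes "matroid M"
  obtains B where "B \<in> bases M"
proof -
  have "indeps M \<noteq> {}" using indep_empty[OF assms] by blast
  then obtain I where "I \<in> indeps M" "\<And>J. J \<in> indeps M \<Longrightarrow> card J \<le> card I"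
    using finite_has_max_card[of "indeps M"] finite_indeps[OF assms] by blast
  then show thesis using that basisI_card[OF assms] by blast
qed

lemma extend_to_basis:
  assumes "matroid M" "I \<in> indeps M"
  obtains B where "B \<in> bases M" "I \<subseteq> B"
  using assms exists_basis extend_to_basis_within by metis

lemma ground_dual [simp]: "ground (dual M) = ground M"
  by (simp add: dual_def)

lemma indeps_dual: "I \<in> indeps (dual M) \<longleftrightarrow> (\<exists>B\<in>bases M. I \<subseteq> ground M - B)"
  by (simp add: dual_def)

section \<open>Duality\<close>

text \<open>Augmentation holds in the dual by counting. Suppose \<open>|I| < |J|\<close>, where \<open>I\<close> avoids the basis \<open>B1\<close>
and \<open>J\<close> avoids the basis \<open>B2\<close>, and extend \<open>B2 - I\<close> by elements of \<open>B1\<close> to a basis \<open>B\<close>, which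
again avoids \<open>I\<close>. If \<open>B\<close> contained all of \<open>J - I\<close>, it would have at least
\<open>|B2 - I| + |J - I| > |B2 - I| + |I - J| \<ge> |B2|\<close> elements. So some element of \<open>J - I\<close> lies
outside \<open>B\<close> and can be added to \<open>I\<close>.\<close>

lemma matroid_dual:
  assumes M: "matroid M"
  shows "matroid (dual M)"
proof (rule matroidI)
  show "finite (ground (dual M))" using M finite_ground by simp
  show "I \<subseteq> ground (dual M)" if "I \<in> indeps (dual M)" for I
    using that by (auto simp: indeps_dual)
  show "{} \<in> indeps (dual M)"
    using exists_basis[OF M] by (auto simp: indeps_dual)
  show "J \<in> indeps (dual M)" if "I \<in> indeps (dual M)" "J \<subseteq> I" for I J
    using that by (auto simp: indeps_dual)
  fix I J assume I: "I \<in> indeps (dual M)" and J: "J \<in> indeps (dual M)" and less: "card I < card J"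
  obtain B1 where B1: "B1 \<in> bases M" "I \<subseteq> ground M - B1" using I by (auto simp: indeps_dual)
  obtain B2 where B2: "B2 \<in> bases M" "J \<subseteq> ground M - B2" using J by (auto simp: indeps_dual)
  have fin: "finite I" "finite J" "finite B2"
    using B1 B2 finite_ground[OF M] basis_finite[OF M] by (auto intro: finite_subset)
  have "B2 - I \<in> indeps M" using B2 basis_indep indep_mono[OF M] by blast
  then obtain B where B: "B \<in> bases M" "B2 - I \<subseteq> B" "B \<subseteq> (B2 - I) \<union> B1"
    using extend_to_basis_within[OF M _ B1(1)] by blast
  have "\<not> J - I \<subseteq> B"
  proof
    assume "J - I \<subseteq> B"
    then have sub: "(B2 - I) \<union> (J - I) \<subseteq> B" using B by blast
    have "card (I - J) < card (J - I)"
      using less fin by (simp add: card_less_sym_Diff)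
    moreover have "card (B2 \<inter> I) \<le> card (I - J)"
      by (rule card_mono) (use fin B2 in auto)
    moreover have "card B2 = card (B2 - I) + card (B2 \<inter> I)"
      using fin by (metis add.commute card_Diff_subset_Int card_mono finite_Int inf_le1 le_add_diff_inverse2)
    moreover have "card ((B2 - I) \<union> (J - I)) = card (B2 - I) + card (J - I)"
      by (rule card_Un_disjoint) (use fin B2 in auto)
    moreover have "card ((B2 - I) \<union> (J - I)) \<le> card B"
      by (rule card_mono) (use sub basis_finite[OF M B(1)] in auto)
    ultimately show False using card_bases_eq[OF M B(1) B2(1)] by linarith
  qed
  then obtain x where "x \<in> J - I" "x \<notin> B" by blast
  moreover have "insert x I \<subseteq> ground M - B" using calculation B B1 B2 by blast
  ultimately show "\<exists>x\<in>J - I. insert x I \<in> indeps (dual M)" using B by (auto simp: indeps_dual)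
qed

lemma bases_dual:
  assumes M: "matroid M"
  shows "B \<in> bases (dual M) \<longleftrightarrow> B \<subseteq> ground M \<and> ground M - B \<in> bases M"
proof
  assume B: "B \<in> bases (dual M)"
  then obtain A where A: "A \<in> bases M" "B \<subseteq> ground M - A"
    using basis_indep[OF B] unfolding indeps_dual by blast
  then have "ground M - A \<in> indeps (dual M)" unfolding indeps_dual by blast
  then have "ground M - A = B" using B A(2) unfolding bases_def by blast
  then have "ground M - B = A" using basis_subset_ground[OF M A(1)] by blast
  then show "B \<subseteq> ground M \<and> ground M - B \<in> bases M" using A by blast
next
  assume B: "B \<subseteq> ground M \<and> ground M - B \<in> bases M"
  have "I = B" if I: "I \<in> indeps (dual M)" and "B \<subseteq> I" for I
  proof -
    obtain A where A: "A \<in> bases M" "I \<subseteq> ground M - A" using I unfolding indeps_dual by blast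
    have "A \<subseteq> ground M - B" using that A basis_subset_ground[OF M A(1)] by blast
    then have "A = ground M - B" using B A(1) basis_indep unfolding bases_def by blast
    then show ?thesis using that A by blast
  qed
  moreover have "B \<in> indeps (dual M)" using B unfolding indeps_dual by blast
  ultimately show "B \<in> bases (dual M)" unfolding bases_def[of "dual M"] by blast
qed

section \<open>Exchange orderings\<close>

text \<open>Exchanging \<open>x\<close> alone replaces \<open>\<sigma> x\<close> by \<open>x\<close> in \<open>B2\<close>. If \<open>x\<close> were already in \<open>B2\<close> and different
from \<open>\<sigma> x\<close>, the result would be too small for a basis.\<close>

lemma exchange_ordering_fixes_common:
  assumes "matroid M" "k \<ge> 1" "B2 \<in> bases M" "k_exchange_ordering k M B1 B2 \<sigma>"
    and x: "x \<in> B1" "x \<in> B2"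
  shows "\<sigma> x = x"
proof (rule ccontr)
  assume ne: "\<sigma> x \<noteq> x"
  have "(B2 - \<sigma> ` {x}) \<union> {x} \<in> bases M"
    using assms unfolding k_exchange_ordering_def by (metis (no_types) card_1_singleton_iff One_nat_def empty_subsetI insert_subset)
  moreover have "(B2 - \<sigma> ` {x}) \<union> {x} = B2 - {\<sigma> x}" using x ne by auto
  ultimately have "card (B2 - {\<sigma> x}) = card B2" using assms card_bases_eq by metis
  moreover have "\<sigma> x \<in> B2" using assms bij_betwE unfolding k_exchange_ordering_def by blast
  moreover have "finite B2" using assms basis_finite by blast
  ultimately show False by (metis card_Diff1_less less_irrefl)
qed

text \<open>The exchange condition is symmetric in the two bases. Finiteness is what turns a bound on the
size of a subset of \<open>B2\<close> into one for its preimage.\<close>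

lemma exchange_ordering_inverse:
  assumes "k_exchange_ordering k M B1 B2 \<sigma>" "finite B2"
  shows "k_exchange_ordering k M B2 B1 (inv_into B1 \<sigma>)"
proof -
  have bij: "bij_betw \<sigma> B1 B2" using assms unfolding k_exchange_ordering_def by blast
  have "(B2 - X) \<union> inv_into B1 \<sigma> ` X \<in> bases M \<and> (B1 - inv_into B1 \<sigma> ` X) \<union> X \<in> bases M"
    if X: "X \<subseteq> B2" "card X \<le> k" for X
  proof -
    let ?Y = "inv_into B1 \<sigma> ` X"
    have "?Y \<subseteq> B1" "\<sigma> ` ?Y = X"
      using bij X(1) by (auto simp: bij_betw_def inv_into_into f_inv_into_f image_image subset_iff)
    moreover have "card ?Y \<le> k"
      using X card_image_le[of X] finite_subset[OF X(1) assms(2)] order_trans by blast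
    ultimately show ?thesis using assms(1) unfolding k_exchange_ordering_def by metis
  qed
  then show ?thesis using bij_betw_inv_into[OF bij] unfolding k_exchange_ordering_def by blast
qed

text \<open>An exchange ordering stripped of the elements that it must fix. This form depends only on
\<open>B1 - B2\<close> and \<open>B2 - B1\<close>, so it survives operations that change \<open>B1 \<inter> B2\<close> or pass to
complements.\<close>

definition strict_exchange_ordering ::
    "nat \<Rightarrow> 'a pre_matroid \<Rightarrow> 'a set \<Rightarrow> 'a set \<Rightarrow> ('a \<Rightarrow> 'a) \<Rightarrow> bool" where
  "strict_exchange_ordering k M B1 B2 \<tau> \<longleftrightarrow>
     bij_betw \<tau> (B1 - B2) (B2 - B1) \<and>
     (\<forall>X. X \<subseteq> B1 - B2 \<and> card X \<le> k \<longrightarrow>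
        (B1 - X) \<union> \<tau> ` X \<in> bases M \<and> (B2 - \<tau> ` X) \<union> X \<in> bases M)"

lemma exchange_ordering_iff_strict:
  assumes M: "matroid M" and k: "k \<ge> 1" and B1: "B1 \<in> bases M" and B2: "B2 \<in> bases M"
  shows "(\<exists>\<sigma>. k_exchange_ordering k M B1 B2 \<sigma>) \<longleftrightarrow> (\<exists>\<tau>. strict_exchange_ordering k M B1 B2 \<tau>)"
proof
  assume "\<exists>\<sigma>. k_exchange_ordering k M B1 B2 \<sigma>"
  then obtain \<sigma> where \<sigma>: "k_exchange_ordering k M B1 B2 \<sigma>" by blast
  then have bij: "bij_betw \<sigma> B1 B2" unfolding k_exchange_ordering_def by blast
  have fix_common: "\<sigma> x = x" if "x \<in> B1 \<inter> B2" for x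
    using exchange_ordering_fixes_common[OF M k B2 \<sigma>] that by blast
  have "\<sigma> ` (B1 - B1 \<inter> B2) = \<sigma> ` B1 - \<sigma> ` (B1 \<inter> B2)"
    using bij by (intro inj_on_image_set_diff[of \<sigma> B1]) (auto simp: bij_betw_def)
  moreover have "\<sigma> ` (B1 \<inter> B2) = B1 \<inter> B2" using fix_common by force
  moreover have "\<sigma> ` B1 = B2" using bij by (simp add: bij_betw_def)
  ultimately have "\<sigma> ` (B1 - B2) = B2 - B1" by (simp add: Diff_Int)
  then have "bij_betw \<sigma> (B1 - B2) (B2 - B1)"
    using bij inj_on_subset[of \<sigma> B1 "B1 - B2"] unfolding bij_betw_def by auto
  then have "strict_exchange_ordering k M B1 B2 \<sigma>"
    using \<sigma> unfolding strict_exchange_ordering_def k_exchange_ordering_def by blast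
  then show "\<exists>\<tau>. strict_exchange_ordering k M B1 B2 \<tau>" by blast
next
  assume "\<exists>\<tau>. strict_exchange_ordering k M B1 B2 \<tau>"
  then obtain \<tau> where \<tau>: "strict_exchange_ordering k M B1 B2 \<tau>" by blast
  define \<sigma> where "\<sigma> x = (if x \<in> B2 then x else \<tau> x)" for x
  have "bij_betw \<tau> (B1 - B2) (B2 - B1)" using \<tau> unfolding strict_exchange_ordering_def by blast
  moreover have "bij_betw \<tau> (B1 - B2) (B2 - B1) \<longleftrightarrow> bij_betw \<sigma> (B1 - B2) (B2 - B1)"
    by (rule bij_betw_cong) (simp add: \<sigma>_def)
  moreover have "bij_betw \<sigma> (B1 \<inter> B2) (B1 \<inter> B2)"
    by (rule bij_betw_imageI) (auto simp: \<sigma>_def inj_on_def)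
  ultimately have "bij_betw \<sigma> ((B1 - B2) \<union> (B1 \<inter> B2)) ((B2 - B1) \<union> (B1 \<inter> B2))"
    by (intro bij_betw_combine) auto
  moreover have "(B1 - B2) \<union> (B1 \<inter> B2) = B1" "(B2 - B1) \<union> (B1 \<inter> B2) = B2" by auto
  ultimately have bij: "bij_betw \<sigma> B1 B2" by simp
  have "(B1 - X) \<union> \<sigma> ` X \<in> bases M \<and> (B2 - \<sigma> ` X) \<union> X \<in> bases M"
    if X: "X \<subseteq> B1" "card X \<le> k" for X
  proof -
    let ?Y = "X - B2"
    have "finite X" using X basis_finite[OF M B1] finite_subset by blast
    then have "card ?Y \<le> k" using X(2) card_mono[of X ?Y] by auto
    moreover have sub: "?Y \<subseteq> B1 - B2" using X(1) by blast
    ultimately have Y: "(B1 - ?Y) \<union> \<tau> ` ?Y \<in> bases M" "(B2 - \<tau> ` ?Y) \<union> ?Y \<in> bases M"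
      using \<tau> unfolding strict_exchange_ordering_def by metis+
    have "\<tau> ` (B1 - B2) = B2 - B1"
      using \<tau> unfolding strict_exchange_ordering_def bij_betw_def by blast
    then have \<tau>Y: "\<tau> ` ?Y \<subseteq> B2 - B1" using sub by blast
    have \<sigma>X: "\<sigma> ` X = \<tau> ` ?Y \<union> (X \<inter> B2)" by (force simp: \<sigma>_def)
    have "(B1 - X) \<union> \<sigma> ` X = (B1 - ?Y) \<union> \<tau> ` ?Y" "(B2 - \<sigma> ` X) \<union> X = (B2 - \<tau> ` ?Y) \<union> ?Y"
      using X(1) \<tau>Y unfolding \<sigma>X by blast+
    then show ?thesis using Y by simp
  qed
  then have "k_exchange_ordering k M B1 B2 \<sigma>" using bij unfolding k_exchange_ordering_def by blast
  then show "\<exists>\<sigma>. k_exchange_ordering k M B1 B2 \<sigma>" by blast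
qed

lemma k_base_orderable_iff_strict:
  assumes "k \<ge> 1"
  shows "k_base_orderable k M \<longleftrightarrow>
    matroid M \<and> (\<forall>B1\<in>bases M. \<forall>B2\<in>bases M. \<exists>\<tau>. strict_exchange_ordering k M B1 B2 \<tau>)"
  using exchange_ordering_iff_strict[OF _ assms] unfolding k_base_orderable_def by blast

lemma k_base_orderable_matroid: "k_base_orderable k M \<Longrightarrow> matroid M"
  by (simp add: k_base_orderable_def)

section \<open>Isomorphisms, duals, minors and direct sums\<close>

text \<open>Independence is prescribed by an isomorphism only for subsets of the ground set, so that the
independent sets of the target lie in its ground set has to be assumed.\<close>

lemma matroid_isomorphic:
  assumes "matroid M" "isomorphic M N" "\<And>I. I \<in> indeps N \<Longrightarrow> I \<subseteq> ground N"
  shows "matroid N"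
proof -
  obtain f where f: "bij_betw f (ground M) (ground N)"
    and ind: "\<And>X. X \<subseteq> ground M \<Longrightarrow> X \<in> indeps M \<longleftrightarrow> f ` X \<in> indeps N"
    using assms(2) unfolding isomorphic_def by blast
  have inj: "inj_on f (ground M)" using f bij_betw_def by blast
  have preimage: "\<exists>X. X \<in> indeps M \<and> I = f ` X" if "I \<in> indeps N" for I
    using that assms(3) f ind unfolding bij_betw_def by (metis subset_imageE)
  have card_f: "card (f ` X) = card X" if "X \<in> indeps M" for X
    using that inj assms(1) indep_subset_ground inj_on_subset card_image by metis
  show ?thesis
  proof (rule matroidI)
    show "finite (ground N)" using assms(1) f finite_ground bij_betw_finite by blast
    show "{} \<in> indeps N" using ind[of "{}"] assms(1) indep_empty by auto
    show "I \<subseteq> ground N" if "I \<in> indeps N" for I using that assms(3) by blast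
    show "J \<in> indeps N" if I: "I \<in> indeps N" and JI: "J \<subseteq> I" for I J
    proof -
      obtain X where X: "X \<in> indeps M" "I = f ` X" using preimage[OF I] by blast
      then obtain Y where "Y \<subseteq> X" "J = f ` Y" using JI subset_imageE by metis
      then show ?thesis
        using X indep_mono[OF assms(1)] ind indep_subset_ground[OF assms(1)] by metis
    qed
    fix I J assume IJ: "I \<in> indeps N" "J \<in> indeps N" "card I < card J"
    obtain X where X: "X \<in> indeps M" "I = f ` X" using preimage[OF IJ(1)] by blast
    obtain Y where Y: "Y \<in> indeps M" "J = f ` Y" using preimage[OF IJ(2)] by blast
    have "card X < card Y" using IJ(3) card_f X Y by simp
    then obtain x where x: "x \<in> Y" "x \<notin> X" "insert x X \<in> indeps M"
      using indep_augment[OF assms(1)] X Y by blast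
    have sub: "X \<subseteq> ground M" "x \<in> ground M"
      using x X indep_subset_ground[OF assms(1)] by blast+
    then have "f x \<notin> I" using inj x X inj_on_image_mem_iff by metis
    moreover have "insert (f x) I \<in> indeps N" using ind[of "insert x X"] x X sub by simp
    ultimately show "\<exists>x\<in>J - I. insert x I \<in> indeps N" using x Y by blast
  qed
qed

lemma k_base_orderable_isomorphic:
  assumes M: "k_base_orderable k M" and N: "matroid N" and iso: "isomorphic M N"
  shows "k_base_orderable k N"
proof -
  note matM = k_base_orderable_matroid[OF M]
  obtain f where f: "bij_betw f (ground M) (ground N)"
    and ind: "\<And>X. X \<subseteq> ground M \<Longrightarrow> X \<in> indeps M \<longleftrightarrow> f ` X \<in> indeps N"
    using iso unfolding isomorphic_def by blast
  have inj: "inj_on f (ground M)" using f bij_betw_def by blast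
  have preimage: "\<exists>X. X \<subseteq> ground M \<and> Y = f ` X" if "Y \<subseteq> ground N" for Y
    using that f unfolding bij_betw_def by (metis subset_imageE)
  have bas: "f ` X \<in> bases N \<longleftrightarrow> X \<in> bases M" if X: "X \<subseteq> ground M" for X
  proof -
    have "(\<forall>I\<in>indeps N. f ` X \<subseteq> I \<longrightarrow> I = f ` X) \<longleftrightarrow> (\<forall>I\<in>indeps M. X \<subseteq> I \<longrightarrow> I = X)"
      (is "?L \<longleftrightarrow> ?R")
    proof
      assume L: ?L
      show ?R
      proof (intro ballI impI)
        fix I assume I: "I \<in> indeps M" "X \<subseteq> I"
        have "I \<subseteq> ground M" using I(1) indep_subset_ground[OF matM] by blast
        then have "f ` I = f ` X" using L I ind by (simp add: image_mono)
        then show "I = X" using inj X \<open>I \<subseteq> ground M\<close> inj_on_image_eq_iff by metis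
      qed
    next
      assume R: ?R
      show ?L
      proof (intro ballI impI)
        fix I assume I: "I \<in> indeps N" "f ` X \<subseteq> I"
        then obtain J where J: "J \<subseteq> ground M" "I = f ` J"
          using preimage[OF indep_subset_ground[OF N I(1)]] by blast
        then have "J \<in> indeps M" using I ind by simp
        moreover have "X \<subseteq> J"
          using I J X inj_on_image_mem_iff[OF inj] by (metis image_subset_iff subset_iff)
        ultimately show "I = f ` X" using R J by blast
      qed
    qed
    then show ?thesis using ind[OF X] unfolding bases_def by blast
  qed
  have "\<exists>\<tau>. k_exchange_ordering k N B1 B2 \<tau>"
    if B: "B1 \<in> bases N" "B2 \<in> bases N" for B1 B2
  proof -
    obtain A1 A2 where A: "A1 \<subseteq> ground M" "B1 = f ` A1" "A2 \<subseteq> ground M" "B2 = f ` A2"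
      using preimage[OF basis_subset_ground[OF N B(1)]] preimage[OF basis_subset_ground[OF N B(2)]]
      by blast
    then have "A1 \<in> bases M" "A2 \<in> bases M" using bas B by auto
    then obtain \<sigma> where \<sigma>: "k_exchange_ordering k M A1 A2 \<sigma>"
      using M unfolding k_base_orderable_def by blast
    define \<tau> where "\<tau> = (f \<circ> \<sigma>) \<circ> inv_into A1 f"
    have injA: "inj_on f A1" "inj_on f A2" using A inj inj_on_subset by blast+
    have "bij_betw \<sigma> A1 A2" using \<sigma> unfolding k_exchange_ordering_def by blast
    then have "bij_betw \<tau> B1 B2"
      unfolding \<tau>_def A using injA
      by (meson bij_betw_inv_into bij_betw_trans inj_on_imp_bij_betw)
    moreover have "(B1 - X) \<union> \<tau> ` X \<in> bases N \<and> (B2 - \<tau> ` X) \<union> X \<in> bases N"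
      if X: "X \<subseteq> B1" "card X \<le> k" for X
    proof -
      obtain Y where Y: "Y \<subseteq> A1" "X = f ` Y" using X(1) A(2) subset_imageE by metis
      have "card Y \<le> k" using X(2) Y injA(1) inj_on_subset card_image by metis
      then have ex: "(A1 - Y) \<union> \<sigma> ` Y \<in> bases M" "(A2 - \<sigma> ` Y) \<union> Y \<in> bases M"
        using \<sigma> Y unfolding k_exchange_ordering_def by auto
      have "\<tau> (f y) = f (\<sigma> y)" if "y \<in> Y" for y
        unfolding \<tau>_def using injA(1) Y that by (auto simp: inv_into_f_f)
      then have \<tau>X: "\<tau> ` X = f ` \<sigma> ` Y" unfolding Y by (force simp: image_image)
      have \<sigma>Y: "\<sigma> ` Y \<subseteq> A2" using \<sigma> Y unfolding k_exchange_ordering_def bij_betw_def by blast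
      have "(B1 - X) \<union> \<tau> ` X = f ` ((A1 - Y) \<union> \<sigma> ` Y)"
        unfolding \<tau>X unfolding Y A using injA(1) Y
        by (simp add: image_Un inj_on_image_set_diff[of f A1])
      moreover have "(B2 - \<tau> ` X) \<union> X = f ` ((A2 - \<sigma> ` Y) \<union> Y)"
        unfolding \<tau>X unfolding Y A using injA(2) \<sigma>Y
        by (simp add: image_Un inj_on_image_set_diff[of f A2])
      moreover have "(A1 - Y) \<union> \<sigma> ` Y \<subseteq> ground M" "(A2 - \<sigma> ` Y) \<union> Y \<subseteq> ground M"
        using A Y \<sigma>Y by blast+
      ultimately show ?thesis using ex bas by simp
    qed
    ultimately show ?thesis unfolding k_exchange_ordering_def by blast
  qed
  then show ?thesis using N unfolding k_base_orderable_def by blast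
qed

text \<open>For complements, \<open>(E - B2) - (E - B1) = B1 - B2\<close>, and exchanging in \<open>E - B2\<close> is the
complement of exchanging in \<open>B2\<close>. So a strict exchange ordering for \<open>E - B2\<close> and \<open>E - B1\<close> in
the matroid is one for \<open>B1\<close> and \<open>B2\<close> in the dual.\<close>

lemma k_base_orderable_dual:
  assumes M: "k_base_orderable k M" and k: "k \<ge> 1"
  shows "k_base_orderable k (dual M)"
proof -
  note matM = k_base_orderable_matroid[OF M]
  have "\<exists>\<tau>. strict_exchange_ordering k (dual M) B1 B2 \<tau>"
    if "B1 \<in> bases (dual M)" "B2 \<in> bases (dual M)" for B1 B2
  proof -
    let ?E = "ground M"
    have B: "B1 \<subseteq> ?E" "?E - B1 \<in> bases M" "B2 \<subseteq> ?E" "?E - B2 \<in> bases M"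
      using that bases_dual[OF matM] by auto
    then obtain \<tau> where \<tau>: "strict_exchange_ordering k M (?E - B2) (?E - B1) \<tau>"
      using M k k_base_orderable_iff_strict by blast
    have diff: "(?E - B2) - (?E - B1) = B1 - B2" "(?E - B1) - (?E - B2) = B2 - B1" using B by blast+
    have "(B1 - X) \<union> \<tau> ` X \<in> bases (dual M) \<and> (B2 - \<tau> ` X) \<union> X \<in> bases (dual M)"
      if X: "X \<subseteq> B1 - B2" "card X \<le> k" for X
    proof -
      have ex: "((?E - B2) - X) \<union> \<tau> ` X \<in> bases M" "((?E - B1) - \<tau> ` X) \<union> X \<in> bases M"
        using \<tau> X unfolding strict_exchange_ordering_def diff by auto
      have "\<tau> ` X \<subseteq> B2 - B1"
        using \<tau> X unfolding strict_exchange_ordering_def diff bij_betw_def by blast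
      then have "?E - ((B1 - X) \<union> \<tau> ` X) = ((?E - B1) - \<tau> ` X) \<union> X"
        "?E - ((B2 - \<tau> ` X) \<union> X) = ((?E - B2) - X) \<union> \<tau> ` X"
        "(B1 - X) \<union> \<tau> ` X \<subseteq> ?E" "(B2 - \<tau> ` X) \<union> X \<subseteq> ?E"
        using X B by blast+
      then show ?thesis using ex bases_dual[OF matM] by simp
    qed
    then have "strict_exchange_ordering k (dual M) B1 B2 \<tau>"
      using \<tau> unfolding strict_exchange_ordering_def diff by blast
    then show ?thesis by blast
  qed
  then show ?thesis using matroid_dual[OF matM] k k_base_orderable_iff_strict by blast
qed

lemma matroid_delete:
  assumes "matroid M"
  shows "matroid (delete M D)"
proof (rule matroidI)
  show "\<exists>x\<in>J - I. insert x I \<in> indeps (delete M D)"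
    if "I \<in> indeps (delete M D)" "J \<in> indeps (delete M D)" "card I < card J" for I J
    using that indep_augment[OF assms, of I J] by (fastforce simp: delete_def)
qed (use assms indep_mono[OF assms] indep_subset_ground[OF assms] in
     \<open>auto simp: delete_def finite_ground indep_empty\<close>)

text \<open>A single set \<open>C\<close> works for all bases of the restriction: if \<open>B0 \<union> C\<close> is a basis of \<open>M\<close> for one
basis \<open>B0\<close> of the restriction, every other basis \<open>B\<close> spans the same set as \<open>B0\<close>, so
\<open>B \<union> C\<close> is a basis as well.\<close>

lemma bases_delete:
  assumes M: "matroid M"
  obtains C where "C \<subseteq> D" "\<And>B. B \<in> bases (delete M D) \<longleftrightarrow> B \<inter> D = {} \<and> B \<union> C \<in> bases M"
proof -
  note mat = matroid_delete[OF M, of D]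
  have ind: "I \<in> indeps (delete M D) \<longleftrightarrow> I \<in> indeps M \<and> I \<inter> D = {}" for I
    by (simp add: delete_def)
  obtain B0 where B0: "B0 \<in> bases (delete M D)" using exists_basis[OF mat] by blast
  then obtain A0 where A0: "A0 \<in> bases M" "B0 \<subseteq> A0"
    using basis_indep ind extend_to_basis[OF M] by metis
  have restrict: "A - D = B" if "A \<in> bases M" "B \<subseteq> A" "B \<in> bases (delete M D)" for A B
  proof -
    have "A - D \<in> indeps (delete M D)"
      using that(1) indep_mono[OF M] basis_indep ind by (metis Diff_disjoint Diff_subset inf_commute)
    moreover have "B \<subseteq> A - D" using that basis_indep ind by blast
    ultimately show ?thesis using that(3) unfolding bases_def by blast
  qed
  let ?C = "A0 \<inter> D"
  have A0_eq: "A0 = B0 \<union> ?C" using restrict[OF A0 B0] by blast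
  have card_Un: "card (B \<union> ?C) = card B + card ?C" if "finite B" "B \<inter> D = {}" for B
    using that basis_finite[OF M A0(1)] by (intro card_Un_disjoint) auto
  have fin: "finite B" if "B \<in> indeps M" for B using that indep_finite[OF M] by blast
  have card_A0: "card A0 = card B0 + card ?C"
    using card_Un[of B0] A0_eq B0 fin basis_indep ind by metis
  have "B \<in> bases (delete M D) \<longleftrightarrow> B \<inter> D = {} \<and> B \<union> ?C \<in> bases M" for B
  proof
    assume B: "B \<in> bases (delete M D)"
    then have BD: "B \<in> indeps M" "B \<inter> D = {}" using basis_indep ind by blast+
    obtain A where A: "A \<in> bases M" "B \<subseteq> A" "A \<subseteq> B \<union> A0"
      using extend_to_basis_within[OF M BD(1) A0(1)] by blast
    have "A \<subseteq> B \<union> ?C" using A restrict[OF A(1,2) B] by blast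
    moreover have "card A = card (B \<union> ?C)"
      using card_A0 card_Un[of B] BD fin card_bases_eq[OF M A(1) A0(1)] card_bases_eq[OF mat B B0] by simp
    moreover have "finite (B \<union> ?C)" using BD fin basis_finite[OF M A0(1)] by simp
    ultimately have "A = B \<union> ?C" using card_subset_eq[of "B \<union> ?C" A] by simp
    then show "B \<inter> D = {} \<and> B \<union> ?C \<in> bases M" using A BD by blast
  next
    assume B: "B \<inter> D = {} \<and> B \<union> ?C \<in> bases M"
    then have BM: "B \<in> indeps M" using basis_indep indep_mono[OF M] by (metis Un_upper1)
    then have "card B = card B0"
      using B card_Un[of B] fin card_A0 card_bases_eq[OF M _ A0(1)] by fastforce
    then show "B \<in> bases (delete M D)" using basis_iff_card[OF mat B0] ind B BM by blast
  qed
  then show thesis using that[of ?C] by blast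
qed

text \<open>Adding the same set \<open>C\<close> to both bases leaves their differences unchanged, so a strict exchange
ordering of the extended bases in \<open>M\<close> can be used as it is.\<close>

lemma k_base_orderable_delete:
  assumes M: "k_base_orderable k M" and k: "k \<ge> 1"
  shows "k_base_orderable k (delete M D)"
proof -
  note matM = k_base_orderable_matroid[OF M]
  obtain C where C: "C \<subseteq> D"
    and bas: "\<And>B. B \<in> bases (delete M D) \<longleftrightarrow> B \<inter> D = {} \<and> B \<union> C \<in> bases M"
    using bases_delete[OF matM] by blast
  have "\<exists>\<tau>. strict_exchange_ordering k (delete M D) B1 B2 \<tau>"
    if "B1 \<in> bases (delete M D)" "B2 \<in> bases (delete M D)" for B1 B2
  proof -
    have B: "B1 \<inter> D = {}" "B1 \<union> C \<in> bases M" "B2 \<inter> D = {}" "B2 \<union> C \<in> bases M"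
      using that bas by auto
    then obtain \<tau> where \<tau>: "strict_exchange_ordering k M (B1 \<union> C) (B2 \<union> C) \<tau>"
      using M k k_base_orderable_iff_strict by blast
    have diff: "(B1 \<union> C) - (B2 \<union> C) = B1 - B2" "(B2 \<union> C) - (B1 \<union> C) = B2 - B1" using B C by blast+
    have "(B1 - X) \<union> \<tau> ` X \<in> bases (delete M D) \<and> (B2 - \<tau> ` X) \<union> X \<in> bases (delete M D)"
      if X: "X \<subseteq> B1 - B2" "card X \<le> k" for X
    proof -
      have ex: "((B1 \<union> C) - X) \<union> \<tau> ` X \<in> bases M" "((B2 \<union> C) - \<tau> ` X) \<union> X \<in> bases M"
        using \<tau> X unfolding strict_exchange_ordering_def diff by auto
      have \<tau>X: "\<tau> ` X \<subseteq> B2 - B1"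
        using \<tau> X unfolding strict_exchange_ordering_def diff bij_betw_def by blast
      then have "((B1 \<union> C) - X) \<union> \<tau> ` X = (B1 - X) \<union> \<tau> ` X \<union> C"
        "((B2 \<union> C) - \<tau> ` X) \<union> X = (B2 - \<tau> ` X) \<union> X \<union> C"
        using X B C by blast+
      moreover have "((B1 - X) \<union> \<tau> ` X) \<inter> D = {}" "((B2 - \<tau> ` X) \<union> X) \<inter> D = {}"
        using X B \<tau>X by blast+
      ultimately show ?thesis using ex bas by simp
    qed
    then have "strict_exchange_ordering k (delete M D) B1 B2 \<tau>"
      using \<tau> unfolding strict_exchange_ordering_def diff by blast
    then show ?thesis by blast
  qed
  then show ?thesis using matroid_delete[OF matM] k k_base_orderable_iff_strict by blast
qed

lemma k_base_orderable_contract: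
  "k_base_orderable k M \<Longrightarrow> k \<ge> 1 \<Longrightarrow> k_base_orderable k (contract M C)"
  by (simp add: contract_def k_base_orderable_dual k_base_orderable_delete)

lemma k_base_orderable_minor:
  "k_base_orderable k M \<Longrightarrow> k \<ge> 1 \<Longrightarrow> minor N M \<Longrightarrow> k_base_orderable k N"
  by (auto simp: minor_def k_base_orderable_contract k_base_orderable_delete)

lemma indeps_direct_sum:
  assumes "matroid M" "matroid N" "ground M \<inter> ground N = {}"
  shows "I \<in> indeps (direct_sum M N) \<longleftrightarrow>
    I \<subseteq> ground M \<union> ground N \<and> I \<inter> ground M \<in> indeps M \<and> I \<inter> ground N \<in> indeps N"
proof
  assume "I \<in> indeps (direct_sum M N)"
  then obtain J K where "I = J \<union> K" "J \<in> indeps M" "K \<in> indeps N"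
    by (auto simp: direct_sum_def)
  moreover have "J \<subseteq> ground M" "K \<subseteq> ground N"
    using calculation assms indep_subset_ground by auto
  moreover have "I \<inter> ground M = J" "I \<inter> ground N = K" using calculation assms by auto
  ultimately show "I \<subseteq> ground M \<union> ground N \<and> I \<inter> ground M \<in> indeps M \<and> I \<inter> ground N \<in> indeps N"
    by auto
next
  assume "I \<subseteq> ground M \<union> ground N \<and> I \<inter> ground M \<in> indeps M \<and> I \<inter> ground N \<in> indeps N"
  moreover have "I = (I \<inter> ground M) \<union> (I \<inter> ground N)" using calculation by blast
  ultimately show "I \<in> indeps (direct_sum M N)" unfolding direct_sum_def by auto
qed

lemma ground_direct_sum [simp]: "ground (direct_sum M N) = ground M \<union> ground N"
  by (simp add: direct_sum_def)

lemma matroid_direct_sum: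
  assumes M: "matroid M" and N: "matroid N" and disj: "ground M \<inter> ground N = {}"
  shows "matroid (direct_sum M N)"
proof (rule matroidI)
  note ind = indeps_direct_sum[OF assms]
  show "finite (ground (direct_sum M N))" using M N finite_ground by auto
  show "{} \<in> indeps (direct_sum M N)"
    using indep_empty[OF M] indep_empty[OF N] ind by simp
  show "I \<subseteq> ground (direct_sum M N)" if "I \<in> indeps (direct_sum M N)" for I
    using that ind by simp
  show "J \<in> indeps (direct_sum M N)" if "I \<in> indeps (direct_sum M N)" "J \<subseteq> I" for I J
  proof -
    have "J \<inter> ground M \<in> indeps M" using that ind indep_mono[OF M] by (meson Int_mono order_refl)
    moreover have "J \<inter> ground N \<in> indeps N" using that ind indep_mono[OF N] by (meson Int_mono order_refl)
    ultimately show ?thesis using that ind by blast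
  qed
  fix I J assume I: "I \<in> indeps (direct_sum M N)" and J: "J \<in> indeps (direct_sum M N)"
    and less: "card I < card J"
  have split: "card K = card (K \<inter> ground M) + card (K \<inter> ground N)"
    if "K \<in> indeps (direct_sum M N)" for K
  proof -
    have "K = (K \<inter> ground M) \<union> (K \<inter> ground N)" using that ind by blast
    moreover have "finite (K \<inter> ground M)" "finite (K \<inter> ground N)"
      using M N finite_ground by auto
    ultimately show ?thesis using disj card_Un_disjoint by (metis Int_assoc inf_bot_right inf_left_commute)
  qed
  consider "card (I \<inter> ground M) < card (J \<inter> ground M)" | "card (I \<inter> ground N) < card (J \<inter> ground N)"
    using less split[OF I] split[OF J] by linarith
  then show "\<exists>x\<in>J - I. insert x I \<in> indeps (direct_sum M N)"
  proof cases
    case 1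
    then obtain x where x: "x \<in> J \<inter> ground M" "x \<notin> I \<inter> ground M" "insert x (I \<inter> ground M) \<in> indeps M"
      using indep_augment[OF M] I J ind by blast
    then have "insert x I \<inter> ground M = insert x (I \<inter> ground M)" "insert x I \<inter> ground N = I \<inter> ground N"
      using disj by auto
    then have "insert x I \<in> indeps (direct_sum M N)" using x I ind by auto
    then show ?thesis using x by blast
  next
    case 2
    then obtain x where x: "x \<in> J \<inter> ground N" "x \<notin> I \<inter> ground N" "insert x (I \<inter> ground N) \<in> indeps N"
      using indep_augment[OF N] I J ind by blast
    then have "insert x I \<inter> ground N = insert x (I \<inter> ground N)" "insert x I \<inter> ground M = I \<inter> ground M"
      using disj by auto
    then have "insert x I \<in> indeps (direct_sum M N)" using x I ind by auto
    then show ?thesis using x by blast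
  qed
qed

lemma bases_direct_sum:
  assumes M: "matroid M" and N: "matroid N" and disj: "ground M \<inter> ground N = {}"
  shows "B \<in> bases (direct_sum M N) \<longleftrightarrow>
    B \<subseteq> ground M \<union> ground N \<and> B \<inter> ground M \<in> bases M \<and> B \<inter> ground N \<in> bases N"
proof
  note ind = indeps_direct_sum[OF assms]
  assume B: "B \<in> bases (direct_sum M N)"
  then have BI: "B \<subseteq> ground M \<union> ground N" "B \<inter> ground M \<in> indeps M" "B \<inter> ground N \<in> indeps N"
    using basis_indep ind by blast+
  have max: "K = B" if "K \<in> indeps (direct_sum M N)" "B \<subseteq> K" for K
    using B that unfolding bases_def by blast
  have "I = B \<inter> ground M" if I: "I \<in> indeps M" "B \<inter> ground M \<subseteq> I" for I
  proof -
    have "I \<subseteq> ground M" using indep_subset_ground[OF M I(1)] .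
    moreover have "I \<union> (B \<inter> ground N) \<in> indeps (direct_sum M N)"
      using I BI unfolding direct_sum_def by auto
    ultimately show ?thesis using max[of "I \<union> (B \<inter> ground N)"] I BI disj by blast
  qed
  moreover have "I = B \<inter> ground N" if I: "I \<in> indeps N" "B \<inter> ground N \<subseteq> I" for I
  proof -
    have "I \<subseteq> ground N" using indep_subset_ground[OF N I(1)] .
    moreover have "(B \<inter> ground M) \<union> I \<in> indeps (direct_sum M N)"
      using I BI unfolding direct_sum_def by auto
    ultimately show ?thesis using max[of "(B \<inter> ground M) \<union> I"] I BI disj by blast
  qed
  ultimately show "B \<subseteq> ground M \<union> ground N \<and> B \<inter> ground M \<in> bases M \<and> B \<inter> ground N \<in> bases N"
    using BI unfolding bases_def by blast
next
  note ind = indeps_direct_sum[OF assms]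
  assume B: "B \<subseteq> ground M \<union> ground N \<and> B \<inter> ground M \<in> bases M \<and> B \<inter> ground N \<in> bases N"
  have "K = B" if K: "K \<in> indeps (direct_sum M N)" "B \<subseteq> K" for K
  proof -
    have "K \<inter> ground M \<in> indeps M" "K \<inter> ground N \<in> indeps N" using K ind by auto
    moreover have "B \<inter> ground M \<subseteq> K \<inter> ground M" "B \<inter> ground N \<subseteq> K \<inter> ground N"
      using K by auto
    ultimately have "K \<inter> ground M = B \<inter> ground M" "K \<inter> ground N = B \<inter> ground N"
      using B unfolding bases_def by auto
    then show ?thesis using B K ind by blast
  qed
  then show "B \<in> bases (direct_sum M N)" using B ind basis_indep unfolding bases_def[of "direct_sum M N"] by blast
qed

lemma k_base_orderable_direct_sum:
  assumes M: "k_base_orderable k M" and N: "k_base_orderable k N" and disj: "ground M \<inter> ground N = {}"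
  shows "k_base_orderable k (direct_sum M N)"
proof -
  note mat = k_base_orderable_matroid[OF M] k_base_orderable_matroid[OF N]
  note bas = bases_direct_sum[OF mat disj]
  have "\<exists>\<sigma>. k_exchange_ordering k (direct_sum M N) B1 B2 \<sigma>"
    if B: "B1 \<in> bases (direct_sum M N)" "B2 \<in> bases (direct_sum M N)" for B1 B2
  proof -
    let ?M = "ground M" and ?N = "ground N"
    have sub: "B1 \<subseteq> ?M \<union> ?N" "B2 \<subseteq> ?M \<union> ?N" using B bas by auto
    obtain \<sigma>1 where \<sigma>1: "k_exchange_ordering k M (B1 \<inter> ?M) (B2 \<inter> ?M) \<sigma>1"
      using M B bas unfolding k_base_orderable_def by blast
    obtain \<sigma>2 where \<sigma>2: "k_exchange_ordering k N (B1 \<inter> ?N) (B2 \<inter> ?N) \<sigma>2"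
      using N B bas unfolding k_base_orderable_def by blast
    define \<sigma> where "\<sigma> x = (if x \<in> ?M then \<sigma>1 x else \<sigma>2 x)" for x
    have "bij_betw \<sigma> (B1 \<inter> ?M) (B2 \<inter> ?M) \<longleftrightarrow> bij_betw \<sigma>1 (B1 \<inter> ?M) (B2 \<inter> ?M)"
      by (rule bij_betw_cong) (simp add: \<sigma>_def)
    moreover have "bij_betw \<sigma> (B1 \<inter> ?N) (B2 \<inter> ?N) \<longleftrightarrow> bij_betw \<sigma>2 (B1 \<inter> ?N) (B2 \<inter> ?N)"
      by (rule bij_betw_cong) (use disj in \<open>auto simp: \<sigma>_def\<close>)
    ultimately have "bij_betw \<sigma> ((B1 \<inter> ?M) \<union> (B1 \<inter> ?N)) ((B2 \<inter> ?M) \<union> (B2 \<inter> ?N))"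
      using \<sigma>1 \<sigma>2 disj unfolding k_exchange_ordering_def by (intro bij_betw_combine) auto
    moreover have "(B1 \<inter> ?M) \<union> (B1 \<inter> ?N) = B1" "(B2 \<inter> ?M) \<union> (B2 \<inter> ?N) = B2"
      using sub by blast+
    ultimately have bij: "bij_betw \<sigma> B1 B2" by simp
    have "(B1 - X) \<union> \<sigma> ` X \<in> bases (direct_sum M N) \<and> (B2 - \<sigma> ` X) \<union> X \<in> bases (direct_sum M N)"
      if X: "X \<subseteq> B1" "card X \<le> k" for X
    proof -
      let ?X1 = "X \<inter> ?M" and ?X2 = "X \<inter> ?N"
      have "finite X"
        using X sub mat finite_ground by (metis finite_Un finite_subset)
      then have "card ?X1 \<le> k" "card ?X2 \<le> k"
        using X(2) card_mono[of X ?X1] card_mono[of X ?X2] by auto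
      then have ex: "(B1 \<inter> ?M - ?X1) \<union> \<sigma>1 ` ?X1 \<in> bases M" "(B2 \<inter> ?M - \<sigma>1 ` ?X1) \<union> ?X1 \<in> bases M"
          "(B1 \<inter> ?N - ?X2) \<union> \<sigma>2 ` ?X2 \<in> bases N" "(B2 \<inter> ?N - \<sigma>2 ` ?X2) \<union> ?X2 \<in> bases N"
        using \<sigma>1 \<sigma>2 X(1) unfolding k_exchange_ordering_def
        by (meson Int_mono order_refl)+
      have "\<sigma>1 ` (B1 \<inter> ?M) = B2 \<inter> ?M" "\<sigma>2 ` (B1 \<inter> ?N) = B2 \<inter> ?N"
        using \<sigma>1 \<sigma>2 unfolding k_exchange_ordering_def bij_betw_def by auto
      then have im: "\<sigma>1 ` ?X1 \<subseteq> B2 \<inter> ?M" "\<sigma>2 ` ?X2 \<subseteq> B2 \<inter> ?N"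
        using X(1) by blast+
      have "\<sigma> ` ?X1 = \<sigma>1 ` ?X1" "\<sigma> ` ?X2 = \<sigma>2 ` ?X2" using disj by (auto simp: \<sigma>_def)
      moreover have "\<sigma> ` X = \<sigma> ` ?X1 \<union> \<sigma> ` ?X2" using X(1) sub by blast
      ultimately have \<sigma>X: "\<sigma> ` X = \<sigma>1 ` ?X1 \<union> \<sigma>2 ` ?X2" by simp
      have "((B1 - X) \<union> \<sigma> ` X) \<inter> ?M = (B1 \<inter> ?M - ?X1) \<union> \<sigma>1 ` ?X1"
        "((B1 - X) \<union> \<sigma> ` X) \<inter> ?N = (B1 \<inter> ?N - ?X2) \<union> \<sigma>2 ` ?X2"
        "((B2 - \<sigma> ` X) \<union> X) \<inter> ?M = (B2 \<inter> ?M - \<sigma>1 ` ?X1) \<union> ?X1"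
        "((B2 - \<sigma> ` X) \<union> X) \<inter> ?N = (B2 \<inter> ?N - \<sigma>2 ` ?X2) \<union> ?X2"
        unfolding \<sigma>X using im disj by blast+
      moreover have "(B1 - X) \<union> \<sigma> ` X \<subseteq> ?M \<union> ?N" "(B2 - \<sigma> ` X) \<union> X \<subseteq> ?M \<union> ?N"
        unfolding \<sigma>X using im sub X(1) by blast+
      ultimately show ?thesis using ex bas by simp
    qed
    then have "k_exchange_ordering k (direct_sum M N) B1 B2 \<sigma>"
      using bij unfolding k_exchange_ordering_def by blast
    then show ?thesis by blast
  qed
  then show ?thesis using matroid_direct_sum[OF mat disj] unfolding k_base_orderable_def by blast
qed

section \<open>Principal extensions\<close>

text \<open>The matroid obtained from \<open>M\<close> by placing the new element \<open>e\<close> as freely as possible in the span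
of \<open>F\<close>: in an independent set, \<open>e\<close> acts as a substitute for some element of \<open>F\<close> that the set
does not contain.\<close>

definition principal_extension :: "'a pre_matroid \<Rightarrow> 'a \<Rightarrow> 'a set \<Rightarrow> 'a pre_matroid" where
  "principal_extension M e F =
     \<lparr>ground = insert e (ground M),
      indeps = {I. if e \<in> I then \<exists>f\<in>F - I. insert f (I - {e}) \<in> indeps M else I \<in> indeps M}\<rparr>"

lemma ground_principal_extension [simp]: "ground (principal_extension M e F) = insert e (ground M)"
  by (simp add: principal_extension_def)

lemma indeps_principal_extension:
  "I \<in> indeps (principal_extension M e F) \<longleftrightarrow>
     (if e \<in> I then \<exists>f\<in>F - I. insert f (I - {e}) \<in> indeps M else I \<in> indeps M)"
  by (simp add: principal_extension_def)

lemma card_insert_remove1: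
  "finite I \<Longrightarrow> e \<in> I \<Longrightarrow> f \<notin> I \<Longrightarrow> card (insert f (I - {e})) = card I"
  using card_Suc_Diff1[of I e] by simp

text \<open>The set \<open>I'\<close> is \<open>I\<close> with \<open>e\<close>, if it occurs, replaced by the element of \<open>F\<close> for which it stands.\<close>

lemma indep_principal_extension_same_card:
  assumes "matroid M" "I \<in> indeps (principal_extension M e F)"
  obtains I' where "I' \<in> indeps M" "card I' = card I" "I' - I \<subseteq> F" "I - {e} \<subseteq> I'" "finite I"
proof (cases "e \<in> I")
  case True
  then obtain f where f: "f \<in> F - I" "insert f (I - {e}) \<in> indeps M"
    using assms(2) indeps_principal_extension by metis
  have fin: "finite I" using indep_finite[OF assms(1) f(2)] by simp
  then have "card (insert f (I - {e})) = card I"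
    using f True fin by (intro card_insert_remove1) auto
  then show thesis using that[of "insert f (I - {e})"] f fin by blast
next
  case False
  then have "I \<in> indeps M" using assms(2) indeps_principal_extension by metis
  then show thesis using that[of I] indep_finite[OF assms(1)] by blast
qed

text \<open>An independent set of the extension is compared with the independent set of \<open>M\<close> in which \<open>e\<close>
is replaced by an element of \<open>F\<close>. The augmentation in \<open>M\<close> may return the replacement itself.
That is a problem only if \<open>e\<close> lies in both sets \<open>I\<close> and \<open>J\<close>. Then \<open>I - {e}\<close> can be extended by two
different elements \<open>x, f\<close> of \<open>F\<close> at once. If \<open>y\<close> is an element of \<open>J - {e}\<close> that augments
\<open>I - {e}\<close>, then at least one of \<open>x\<close> and \<open>f\<close> is independent of \<open>(I - {e}) \<union> {y}\<close> and
can be the element for which \<open>e\<close> stands.\<close>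

lemma matroid_principal_extension:
  assumes M: "matroid M" and e: "e \<notin> ground M" and F: "F \<subseteq> ground M"
  shows "matroid (principal_extension M e F)" (is "matroid ?P")
proof (rule matroidI)
  note ind = indeps_principal_extension[of _ M e F]
  have no_e: "e \<notin> I" if "I \<in> indeps M" for I using that indep_subset_ground[OF M] e by blast
  show "finite (ground ?P)" using finite_ground[OF M] by simp
  show "{} \<in> indeps ?P" using indep_empty[OF M] ind by simp
  show "I \<subseteq> ground ?P" if "I \<in> indeps ?P" for I
    using that indep_subset_ground[OF M] ind[of I] by (auto split: if_splits)
  show "J \<in> indeps ?P" if I: "I \<in> indeps ?P" and JI: "J \<subseteq> I" for I J
  proof (cases "e \<in> I")
    case True
    then obtain f where f: "f \<in> F - I" "insert f (I - {e}) \<in> indeps M" using I ind by metis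
    have "insert f (J - {e}) \<in> indeps M"
      using indep_mono[OF M f(2), of "insert f (J - {e})"] JI by auto
    moreover have "J - {e} \<in> indeps M" using indep_mono[OF M f(2), of "J - {e}"] JI by auto
    ultimately show ?thesis using f(1) JI ind[of J] by (cases "e \<in> J") auto
  next
    case False
    then have "I \<in> indeps M" using I ind by metis
    then show ?thesis using indep_mono[OF M _ JI] False JI ind[of J] by auto
  qed
  fix I J assume I: "I \<in> indeps ?P" and J: "J \<in> indeps ?P" and less: "card I < card J"
  obtain J' where J': "J' \<in> indeps M" "card J' = card J" "J' - J \<subseteq> F" "J - {e} \<subseteq> J'" "finite J"
    using indep_principal_extension_same_card[OF M J] by blast
  show "\<exists>x\<in>J - I. insert x I \<in> indeps ?P"
  proof (cases "e \<in> I")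
    case False
    then have IM: "I \<in> indeps M" using I ind by metis
    obtain x where x: "x \<in> J'" "x \<notin> I" "insert x I \<in> indeps M"
      using indep_augment[OF M IM J'(1)] less J' by auto
    show ?thesis
    proof (cases "x \<in> J")
      case True
      moreover have "insert x I \<in> indeps ?P" using x(3) no_e ind[of "insert x I"] by auto
      ultimately show ?thesis using x by blast
    next
      case False
      \<comment> \<open>Here \<open>x\<close> is the replacement of \<open>e\<close>, so that \<open>e\<close> itself can be added to \<open>I\<close>.\<close>
      have "e \<in> J"
      proof (rule ccontr)
        assume "e \<notin> J"
        then have "J \<subseteq> J'" using J' by blast
        then have "J = J'" using J' indep_finite[OF M] card_subset_eq by metis
        then show False using x False by blast
      qed
      moreover have "insert e I \<in> indeps ?P"
        using x J'(3) False \<open>e \<notin> I\<close> no_e[OF J'(1)] ind[of "insert e I"] by auto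
      ultimately show ?thesis using \<open>e \<notin> I\<close> by blast
    qed
  next
    case True
    then obtain f where f: "f \<in> F - I" "insert f (I - {e}) \<in> indeps M" using I ind by metis
    let ?I0 = "I - {e}"
    have finI: "finite I" using indep_finite[OF M f(2)] by simp
    have I0: "?I0 \<in> indeps M" using indep_mono[OF M f(2)] by blast
    have card_f: "card (insert f ?I0) = card I" using f(1) True finI by (intro card_insert_remove1) auto
    have goodI: "insert x I \<in> indeps ?P" if "insert f (insert x ?I0) \<in> indeps M" "x \<noteq> f" for x
    proof -
      have "x \<noteq> e" using no_e that(1) by blast
      then have "insert x I - {e} = insert x ?I0" by blast
      then show ?thesis using that f(1) True ind[of "insert x I"] by auto
    qed
    obtain x where x: "x \<in> J'" "x \<notin> insert f ?I0" "insert x (insert f ?I0) \<in> indeps M"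
      using indep_augment[OF M f(2) J'(1)] less J' card_f by auto
    show ?thesis
    proof (cases "x \<in> J")
      case True
      then show ?thesis using x goodI[of x] no_e[OF x(3)] by (auto simp: insert_commute)
    next
      case False
      then have xF: "x \<in> F" using J'(3) x(1) by blast
      let ?D = "insert x (insert f ?I0)"
      have "Suc (card ?I0) = card I" using finI True by (rule card_Suc_Diff1)
      moreover have "card J \<le> Suc (card (J - {e}))"
        using J'(5) by (cases "e \<in> J") (metis card_Suc_Diff1 order_refl, simp)
      ultimately have "card ?I0 < card (J - {e})" using less by linarith
      moreover have "J - {e} \<in> indeps M" using indep_mono[OF M J'(1,4)] .
      ultimately obtain y where y: "y \<in> J - {e}" "y \<notin> ?I0" "insert y ?I0 \<in> indeps M"
        using indep_augment[OF M I0] by blast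
      have "card ?D = Suc (Suc (card ?I0))" using x(2) f(1) finI by simp
      moreover have "card (insert y ?I0) = Suc (card ?I0)" using y(2) finI by simp
      ultimately obtain z where z: "z \<in> ?D" "z \<notin> insert y ?I0" "insert z (insert y ?I0) \<in> indeps M"
        using indep_augment[OF M y(3) x(3)] by auto
      have zF: "z \<in> F" "z \<notin> I" using z xF f(1) no_e[OF x(3)] by auto
      have "insert y I - {e} = insert y ?I0" using y by auto
      then have "insert y I \<in> indeps ?P" using z zF True ind[of "insert y I"] by auto
      then show ?thesis using y by blast
    qed
  qed
qed

text \<open>The extension has the same rank as \<open>M\<close>, because replacing \<open>e\<close> by the element for which it stands
preserves cardinalities.\<close>

lemma bases_principal_extension:
  assumes M: "matroid M" and e: "e \<notin> ground M" and F: "F \<subseteq> ground M"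
  shows "B \<in> bases (principal_extension M e F) \<longleftrightarrow>
     (if e \<in> B then \<exists>f\<in>F - B. insert f (B - {e}) \<in> bases M else B \<in> bases M)"
    (is "B \<in> bases ?P \<longleftrightarrow> _")
proof -
  note matP = matroid_principal_extension[OF assms]
  obtain B0 where B0: "B0 \<in> bases M" using exists_basis[OF M] by blast
  have "e \<notin> B0" using basis_subset_ground[OF M B0] e by blast
  then have "B0 \<in> indeps ?P" using basis_indep[OF B0] by (simp add: indeps_principal_extension)
  moreover have "card I \<le> card B0" if "I \<in> indeps ?P" for I
    using indep_principal_extension_same_card[OF M that] card_indep_le_basis[OF M B0] by metis
  ultimately have "B0 \<in> bases ?P" using basisI_card[OF matP] by blast
  then have bas: "B \<in> bases ?P \<longleftrightarrow> B \<in> indeps ?P \<and> card B = card B0"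
    using basis_iff_card[OF matP] by blast
  have "card (insert f (B - {e})) = card B" if "f \<in> F - B" "e \<in> B" "insert f (B - {e}) \<in> indeps M" for f
  proof -
    have "finite B" using indep_finite[OF M that(3)] by simp
    then show ?thesis using that by (intro card_insert_remove1) auto
  qed
  then show ?thesis
    unfolding bas indeps_principal_extension basis_iff_card[OF M B0] by auto
qed

text \<open>For \<open>I = C \<union> {x}\<close> this is a statement about rank two, modulo \<open>C\<close>: a non-loop \<open>x\<close> cannot be
parallel to both of two spanning elements \<open>f1, f2\<close>.\<close>

lemma basis_with_one_of_two:
  assumes M: "matroid M"
    and I: "insert a I \<in> bases M" "a \<notin> I"
    and C: "insert f1 (insert f2 C) \<in> bases M" "C \<subseteq> I"
  obtains f where "f \<in> {f1, f2}" "f \<notin> I" "insert f I \<in> bases M"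
proof -
  have "I \<in> indeps M" using indep_mono[OF M basis_indep[OF I(1)]] by blast
  moreover have fin: "finite I" using basis_finite[OF M I(1)] by simp
  moreover have "card (insert f1 (insert f2 C)) = Suc (card I)"
    using card_bases_eq[OF M C(1) I(1)] I(2) fin by simp
  ultimately obtain f where f: "f \<in> insert f1 (insert f2 C)" "f \<notin> I" "insert f I \<in> indeps M"
    using indep_augment[OF M _ basis_indep[OF C(1)], of I] by auto
  have "card (insert f I) = card (insert a I)" using f(2) I(2) fin by simp
  then have "insert f I \<in> bases M" using basis_iff_card[OF M I(1)] f(3) by blast
  then show thesis using that f C(2) by blast
qed

text \<open>If only \<open>B1\<close> contains \<open>e\<close>, let \<open>e\<close> take the place of the element \<open>f\<close> for which it stands. On the
side of an exchange where \<open>e\<close> ends up, \<open>f\<close> must not occur as an element of its own. Only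
\<open>f \<in> B2\<close> could cause this, but then \<open>f\<close> is a common element of the two bases of \<open>M\<close> and fixed
by \<open>\<sigma>\<close>.\<close>

lemma exchange_ordering_principal_one:
  assumes M: "matroid M" and k: "k \<ge> 1" and e: "e \<notin> ground M" and F: "F \<subseteq> ground M"
    and B1: "e \<in> B1" and f: "f \<in> F - B1" and A1: "insert f (B1 - {e}) \<in> bases M"
    and B2: "B2 \<in> bases M"
    and \<sigma>: "k_exchange_ordering k M (insert f (B1 - {e})) B2 \<sigma>"
  shows "k_exchange_ordering k (principal_extension M e F) B1 B2 (\<sigma> \<circ> (id(e := f)))"
proof -
  let ?P = "principal_extension M e F" and ?A = "B1 - {e}"
  define \<phi> where "\<phi> = id(e := f)"
  note bas = bases_principal_extension[OF M e F]
  have no_e: "e \<notin> B" if "B \<in> bases M" for B using that basis_subset_ground[OF M] e by blast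
  have no_e2: "e \<notin> B2" using no_e B2 by blast
  have f_new: "f \<notin> ?A" "f \<noteq> e" using f B1 by auto
  have \<phi>_simps: "\<phi> e = f" "\<And>x. x \<noteq> e \<Longrightarrow> \<phi> x = x" by (auto simp: \<phi>_def)
  have bij\<sigma>: "bij_betw \<sigma> (insert f ?A) B2" using \<sigma> unfolding k_exchange_ordering_def by blast
  have "bij_betw \<phi> B1 (insert f ?A)"
    by (rule bij_betw_imageI) (use B1 f_new in \<open>auto simp: \<phi>_def inj_on_def\<close>)
  then have bij: "bij_betw (\<sigma> \<circ> \<phi>) B1 B2" using bij\<sigma> by (rule bij_betw_trans)
  have f_fix: "f \<in> B2 \<Longrightarrow> \<sigma> f = f"
    using exchange_ordering_fixes_common[OF M k B2 \<sigma>] by blast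
  have same: "C \<in> bases ?P" if "C \<in> bases M" for C using that no_e[OF that] bas by simp
  have swap: "C \<in> bases ?P" if "e \<in> C" "f \<notin> C" "insert f (C - {e}) \<in> bases M" for C
    using that f bas[of C] by auto
  have "(B1 - X) \<union> (\<sigma> \<circ> \<phi>) ` X \<in> bases ?P \<and> (B2 - (\<sigma> \<circ> \<phi>) ` X) \<union> X \<in> bases ?P"
    if X: "X \<subseteq> B1" "card X \<le> k" for X
  proof -
    let ?Y = "\<phi> ` X"
    have Ysub: "?Y \<subseteq> insert f ?A" using X(1) by (auto simp: \<phi>_def)
    moreover have "finite X" using X(1) basis_finite[OF M A1] by (meson finite_Diff2 finite_insert finite.emptyI finite_subset)
    then have "card ?Y \<le> k" using X(2) card_image_le[of X \<phi>] by linarith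
    ultimately have ex: "(insert f ?A - ?Y) \<union> \<sigma> ` ?Y \<in> bases M" "(B2 - \<sigma> ` ?Y) \<union> ?Y \<in> bases M"
      using \<sigma> unfolding k_exchange_ordering_def by auto
    have \<sigma>Y: "\<sigma> ` ?Y \<subseteq> B2" using bij\<sigma> Ysub unfolding bij_betw_def by blast
    have comp: "(\<sigma> \<circ> \<phi>) ` X = \<sigma> ` ?Y" by (simp add: image_comp)
    show ?thesis
    proof (cases "e \<in> X")
      case True
      then have Y: "?Y = insert f (X - {e})" by (auto simp: \<phi>_def)
      have "(B1 - X) \<union> \<sigma> ` ?Y = (insert f ?A - ?Y) \<union> \<sigma> ` ?Y"
        using True f_new B1 unfolding Y by auto
      then have "(B1 - X) \<union> \<sigma> ` ?Y \<in> bases ?P" using same ex(1) by simp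
      moreover have "(B2 - \<sigma> ` ?Y) \<union> X \<in> bases ?P"
      proof (rule swap)
        show "e \<in> (B2 - \<sigma> ` ?Y) \<union> X" using True by blast
        have "f \<in> B2 \<Longrightarrow> f \<in> \<sigma> ` ?Y" using f_fix unfolding Y by (metis image_eqI insertI1)
        then show "f \<notin> (B2 - \<sigma> ` ?Y) \<union> X" using f X(1) by blast
        have "insert f ((B2 - \<sigma> ` ?Y) \<union> X - {e}) = (B2 - \<sigma> ` ?Y) \<union> ?Y"
          using no_e2 unfolding Y by blast
        then show "insert f ((B2 - \<sigma> ` ?Y) \<union> X - {e}) \<in> bases M" using ex(2) by simp
      qed
      ultimately show ?thesis unfolding comp by blast
    next
      case False
      then have Y: "?Y = X" by (auto simp: \<phi>_def image_iff)
      have fX: "f \<notin> X" using X(1) f by blast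
      have "f \<notin> \<sigma> ` X"
      proof
        assume "f \<in> \<sigma> ` X"
        then obtain x where x: "x \<in> X" "\<sigma> x = f" by blast
        then have "\<sigma> f = \<sigma> x" using f_fix \<sigma>Y Y by auto
        moreover have "x \<in> insert f ?A" using x(1) Ysub Y by blast
        ultimately have "f = x"
          using bij_betw_imp_inj_on[OF bij\<sigma>] inj_onD[of \<sigma> "insert f ?A" f x] by blast
        then show False using x fX by blast
      qed
      then have "f \<notin> (B1 - X) \<union> \<sigma> ` X" using f by blast
      moreover have "insert f ((B1 - X) \<union> \<sigma> ` X - {e}) = (insert f ?A - ?Y) \<union> \<sigma> ` ?Y"
        using fX \<sigma>Y no_e2 unfolding Y by blast
      moreover have "e \<in> (B1 - X) \<union> \<sigma> ` X" using False B1 by blast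
      ultimately have "(B1 - X) \<union> \<sigma> ` X \<in> bases ?P" using swap ex(1) by simp
      moreover have "(B2 - \<sigma> ` X) \<union> X \<in> bases ?P" using same ex(2) unfolding Y by blast
      ultimately show ?thesis unfolding comp Y by blast
    qed
  qed
  then have "k_exchange_ordering k ?P B1 B2 (\<sigma> \<circ> \<phi>)"
    using bij unfolding k_exchange_ordering_def by blast
  then show ?thesis by (simp add: \<phi>_def)
qed

text \<open>Suppose that \<open>e\<close> stands for \<open>f1\<close> in \<open>B1\<close> and for \<open>f2\<close> in \<open>B2\<close>. The new ordering fixes \<open>e\<close> and, if
\<open>\<sigma> a1 = f2\<close> and \<open>\<sigma> f1 = a2\<close> with \<open>a1 \<noteq> f1\<close>, short-circuits these two pairs to \<open>a1 \<mapsto> a2\<close>. Exchanging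
a set \<open>X\<close> that does not contain \<open>a1\<close> is exchanging \<open>X\<close> in \<open>M\<close>, with \<open>e\<close> standing for \<open>f1\<close> and \<open>f2\<close>
as before.

Now let \<open>a1 \<in> X\<close>. Using \<open>\<sigma>\<close> on both pairs would mean to exchange \<open>X \<union> {f1}\<close>, which may exceed the
bound \<open>k\<close>. But \<open>X\<close> and \<open>(X - {a1}) \<union> {f1}\<close> are within the bound. Writing \<open>Y = X - {a1}\<close> and
\<open>C = (A1 - X) \<union> \<sigma> ` Y\<close> with \<open>A1 = B1 - {e}\<close>, they show that \<open>C \<union> {f1, f2}\<close> and
\<open>C \<union> {a1, a2}\<close> are bases. Hence one of \<open>C \<union> {a2, f1}\<close> and \<open>C \<union> {a2, f2}\<close> is a basis, and \<open>e\<close> can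
stand for \<open>f1\<close> or \<open>f2\<close> there. The other side of the exchange is analogous.\<close>

lemma exchange_ordering_principal_both:
  assumes M: "matroid M" and k: "k \<ge> 1" and e: "e \<notin> ground M" and F: "F \<subseteq> ground M"
    and B1: "e \<in> B1" and f1: "f1 \<in> F - B1" and S1: "insert f1 (B1 - {e}) \<in> bases M"
    and B2: "e \<in> B2" and f2: "f2 \<in> F - B2" and S2: "insert f2 (B2 - {e}) \<in> bases M"
    and \<sigma>: "k_exchange_ordering k M (insert f1 (B1 - {e})) (insert f2 (B2 - {e})) \<sigma>"
  shows "k_exchange_ordering k (principal_extension M e F) B1 B2
           (\<lambda>x. if x = e then e else if \<sigma> x = f2 then \<sigma> f1 else \<sigma> x)"
proof -
  let ?P = "principal_extension M e F"
  define A1 where "A1 = B1 - {e}"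
  define A2 where "A2 = B2 - {e}"
  define \<tau> where "\<tau> x = (if x = e then e else if \<sigma> x = f2 then \<sigma> f1 else \<sigma> x)" for x
  have B_eq: "B1 = insert e A1" "B2 = insert e A2" using B1 B2 by (auto simp: A1_def A2_def)
  note S1 = S1[folded A1_def] and S2 = S2[folded A2_def] and \<sigma> = \<sigma>[folded A1_def A2_def]
  have no_e: "e \<notin> A1" "e \<notin> A2" "e \<noteq> f1" "e \<noteq> f2" using f1 f2 F e by (auto simp: A1_def A2_def)
  have f_new: "f1 \<notin> A1" "f2 \<notin> A2" using f1 f2 by (auto simp: A1_def A2_def)
  have finA: "finite A1" "finite A2" using basis_finite[OF M S1] basis_finite[OF M S2] by auto
  have bij\<sigma>: "bij_betw \<sigma> (insert f1 A1) (insert f2 A2)"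
    using \<sigma> unfolding k_exchange_ordering_def by blast
  have inj: "\<And>x y. x \<in> insert f1 A1 \<Longrightarrow> y \<in> insert f1 A1 \<Longrightarrow> \<sigma> x = \<sigma> y \<Longrightarrow> x = y"
    using bij\<sigma> unfolding bij_betw_def inj_on_def by blast
  have into: "\<And>x. x \<in> insert f1 A1 \<Longrightarrow> \<sigma> x \<in> insert f2 A2" using bij\<sigma> bij_betwE by blast
  have common: "\<And>x. x \<in> insert f1 A1 \<Longrightarrow> x \<in> insert f2 A2 \<Longrightarrow> \<sigma> x = x"
    using exchange_ordering_fixes_common[OF M k S2 \<sigma>] by blast
  have ex: "(insert f1 A1 - X) \<union> \<sigma> ` X \<in> bases M" "(insert f2 A2 - \<sigma> ` X) \<union> X \<in> bases M"
    if "X \<subseteq> insert f1 A1" "card X \<le> k" for X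
    using \<sigma> that unfolding k_exchange_ordering_def by auto
  have "inj_on \<tau> A1"
  proof (rule inj_onI)
    fix x y assume xy: "x \<in> A1" "y \<in> A1" "\<tau> x = \<tau> y"
    then have "x \<noteq> e" "y \<noteq> e" using no_e by auto
    then have eq: "(if \<sigma> x = f2 then \<sigma> f1 else \<sigma> x) = (if \<sigma> y = f2 then \<sigma> f1 else \<sigma> y)"
      using xy(3) by (simp add: \<tau>_def)
    have mem: "x \<in> insert f1 A1" "y \<in> insert f1 A1" "x \<noteq> f1" "y \<noteq> f1"
      using xy f_new(1) by auto
    then have "\<sigma> x \<noteq> \<sigma> f1" "\<sigma> y \<noteq> \<sigma> f1" using inj[of x f1] inj[of y f1] by blast+
    then have "\<sigma> x = \<sigma> y" using eq by (cases "\<sigma> x = f2"; cases "\<sigma> y = f2") auto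
    then show "x = y" using inj mem by blast
  qed
  moreover have \<tau>_into: "\<tau> x \<in> A2" if x: "x \<in> A1" for x
  proof (cases "\<sigma> x = f2")
    case True
    have "x \<noteq> f1" using x f_new(1) by blast
    then have "\<sigma> f1 \<noteq> f2" using inj[of x f1] x True by (metis insertI1 insertI2)
    then have "\<sigma> f1 \<in> A2" using into[of f1] by blast
    moreover have "x \<noteq> e" using x no_e by blast
    ultimately show ?thesis using True by (simp add: \<tau>_def)
  next
    case False
    then show ?thesis using x no_e into[of x] by (auto simp: \<tau>_def)
  qed
  moreover have "card A1 = card A2"
    using card_bases_eq[OF M S1 S2] f_new finA by simp
  ultimately have "bij_betw \<tau> A1 A2"
    using finA by (metis bij_betw_def card_image card_subset_eq image_subsetI)
  moreover have \<tau>_e: "\<tau> e = e" by (simp add: \<tau>_def)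
  ultimately have bij: "bij_betw \<tau> B1 B2"
    unfolding B_eq using no_e notIn_Un_bij_betw[of e A1 \<tau> A2] by simp
  have main: "(\<exists>f\<in>F. f \<notin> (A1 - X) \<union> \<tau> ` X \<and> insert f ((A1 - X) \<union> \<tau> ` X) \<in> bases M) \<and>
              (\<exists>f\<in>F. f \<notin> (A2 - \<tau> ` X) \<union> X \<and> insert f ((A2 - \<tau> ` X) \<union> X) \<in> bases M)"
    if X: "X \<subseteq> A1" "card X \<le> k" for X
  proof (cases "f2 \<in> \<sigma> ` X")
    case False
    have "\<tau> x = \<sigma> x" if "x \<in> X" for x
    proof -
      have "\<sigma> x \<noteq> f2" using False that by blast
      moreover have "x \<noteq> e" using that X(1) no_e by blast
      ultimately show ?thesis by (simp add: \<tau>_def)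
    qed
    then have \<tau>X: "\<tau> ` X = \<sigma> ` X" by (rule image_cong[OF refl])
    have "f1 \<notin> \<sigma> ` X"
    proof
      assume "f1 \<in> \<sigma> ` X"
      then obtain x where x: "x \<in> X" "\<sigma> x = f1" by blast
      then have "\<sigma> f1 = f1" using into[of x] common[of f1] X(1) by auto
      then show False using inj[of x f1] x X(1) f_new(1) by auto
    qed
    moreover have "f2 \<notin> X" using common[of f2] False X(1) by force
    ultimately have "f1 \<notin> (A1 - X) \<union> \<sigma> ` X" "f2 \<notin> (A2 - \<sigma> ` X) \<union> X" using f_new by blast+
    moreover have "insert f1 ((A1 - X) \<union> \<sigma> ` X) = (insert f1 A1 - X) \<union> \<sigma> ` X"
      "insert f2 ((A2 - \<sigma> ` X) \<union> X) = (insert f2 A2 - \<sigma> ` X) \<union> X"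
      using f_new(1) X(1) False by blast+
    ultimately show ?thesis unfolding \<tau>X using f1 f2 ex[of X] X by (metis Diff_iff subset_insertI2)
  next
    case True
    then obtain a1 where a1: "a1 \<in> X" "\<sigma> a1 = f2" by auto
    define a2 where "a2 = \<sigma> f1"
    define Y where "Y = X - {a1}"
    have XY: "X = insert a1 Y" "a1 \<notin> Y" "Y \<subseteq> A1" "a1 \<in> A1" "f1 \<notin> Y" "a1 \<noteq> f1"
      using a1 X(1) f_new(1) by (auto simp: Y_def)
    have ne: "\<sigma> y \<noteq> f2" "\<sigma> y \<noteq> a2" if "y \<in> Y" for y
      using that XY inj[of y a1] inj[of y f1] a1(2) by (auto simp: a2_def)
    have a2: "a2 \<noteq> f2" "a2 \<in> A2"
      using inj[of a1 f1] a1(2) XY into[of f1] by (auto simp: a2_def)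
    have "\<tau> y = \<sigma> y" if "y \<in> Y" for y using that ne XY no_e by (auto simp: \<tau>_def)
    moreover have "\<tau> a1 = a2" using a1(2) XY no_e by (auto simp: \<tau>_def a2_def)
    ultimately have \<tau>X: "\<tau> ` X = insert a2 (\<sigma> ` Y)" unfolding XY(1) by simp
    have \<sigma>X: "\<sigma> ` X = insert f2 (\<sigma> ` Y)" unfolding XY(1) using a1(2) by simp
    let ?X' = "insert f1 Y"
    have \<sigma>X': "\<sigma> ` ?X' = insert a2 (\<sigma> ` Y)" by (simp add: a2_def)
    have "finite Y" using XY finA finite_subset by blast
    then have X': "?X' \<subseteq> insert f1 A1" "card ?X' \<le> k"
      using X XY by (auto simp: XY(1))
    have fixed: "\<sigma> y \<noteq> a1" if "y \<in> insert f1 Y" for y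
    proof
      assume "\<sigma> y = a1"
      then have "\<sigma> a1 = a1" using common[of a1] into[of y] that XY by auto
      then show False using inj[of y a1] that XY \<open>\<sigma> y = a1\<close> by auto
    qed
    have a2X: "a2 \<notin> X"
    proof
      assume "a2 \<in> X"
      then have "\<sigma> a2 = a2" using common[of a2] a2 X(1) by auto
      then show False using inj[of a2 f1] \<open>a2 \<in> X\<close> X(1) f_new(1) by (auto simp: a2_def)
    qed

    \<comment> \<open>The side of \<open>B1\<close>: exchanging \<open>?X'\<close> gives \<open>p1\<close>, exchanging \<open>X\<close> gives \<open>p3\<close>.\<close>
    let ?C1 = "(A1 - X) \<union> \<tau> ` X"
    have p1: "insert a1 ?C1 \<in> bases M"
    proof -
      have "insert a1 ?C1 = (insert f1 A1 - ?X') \<union> \<sigma> ` ?X'"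
        unfolding \<tau>X \<sigma>X' using XY f_new(1) by auto
      then show ?thesis using ex(1)[OF X'] by simp
    qed
    have p2: "a1 \<notin> ?C1" using fixed a1(1) unfolding \<tau>X a2_def by force
    have p3: "insert f1 (insert f2 ((A1 - X) \<union> \<sigma> ` Y)) \<in> bases M"
    proof -
      have "insert f1 (insert f2 ((A1 - X) \<union> \<sigma> ` Y)) = (insert f1 A1 - X) \<union> \<sigma> ` X"
        unfolding \<sigma>X using X(1) f_new(1) by auto
      then show ?thesis using ex(1)[of X] X by auto
    qed
    have p4: "(A1 - X) \<union> \<sigma> ` Y \<subseteq> ?C1" unfolding \<tau>X by blast
    obtain g1 where g1: "g1 \<in> {f1, f2}" "g1 \<notin> ?C1" "insert g1 ?C1 \<in> bases M"
      using basis_with_one_of_two[OF M p1 p2 p3 p4] by blast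

    \<comment> \<open>The side of \<open>B2\<close>, where the two exchanges trade roles.\<close>
    let ?C2 = "(A2 - \<tau> ` X) \<union> X"
    have q1: "insert a2 ?C2 \<in> bases M"
    proof -
      have "insert a2 ?C2 = (insert f2 A2 - \<sigma> ` X) \<union> X"
        unfolding \<tau>X \<sigma>X using a2 f_new(2) ne by auto
      then show ?thesis using ex(2)[of X] X by auto
    qed
    have q2: "a2 \<notin> ?C2" using a2X unfolding \<tau>X by blast
    have q3: "insert f1 (insert f2 ((A2 - \<tau> ` X) \<union> Y)) \<in> bases M"
    proof -
      have "insert f1 (insert f2 ((A2 - \<tau> ` X) \<union> Y)) = (insert f2 A2 - \<sigma> ` ?X') \<union> ?X'"
        unfolding \<tau>X \<sigma>X' using a2 ne by auto
      then show ?thesis using ex(2)[OF X'] by simp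
    qed
    have q4: "(A2 - \<tau> ` X) \<union> Y \<subseteq> ?C2" unfolding XY(1) by blast
    obtain g2 where g2: "g2 \<in> {f1, f2}" "g2 \<notin> ?C2" "insert g2 ?C2 \<in> bases M"
      using basis_with_one_of_two[OF M q1 q2 q3 q4] by blast
    show ?thesis using g1 g2 f1 f2 by blast
  qed
  have basisP: "insert e C \<in> bases ?P" if "\<exists>f\<in>F. f \<notin> C \<and> insert f C \<in> bases M" for C
  proof -
    obtain f where f: "f \<in> F" "f \<notin> C" "insert f C \<in> bases M" using \<open>\<exists>f\<in>F. _ f\<close> by blast
    then have "e \<notin> C" "f \<noteq> e" using basis_subset_ground[OF M f(3)] e by auto
    then show ?thesis using f bases_principal_extension[OF M e F, of "insert e C"] by auto
  qed
  have "(B1 - X) \<union> \<tau> ` X \<in> bases ?P \<and> (B2 - \<tau> ` X) \<union> X \<in> bases ?P"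
    if X: "X \<subseteq> B1" "card X \<le> k" for X
  proof -
    let ?X0 = "X - {e}"
    have X0: "?X0 \<subseteq> A1" using X(1) by (auto simp: A1_def)
    then have "finite X" using finA finite_subset by (metis finite_Diff2 finite.emptyI finite_insert)
    then have "card ?X0 \<le> k" using X(2) card_mono[of X ?X0] by auto
    note main = main[OF X0 this]
    have "\<tau> ` ?X0 \<subseteq> A2" using \<tau>_into X0 by blast
    then have e_im: "e \<notin> \<tau> ` ?X0" using no_e by blast
    have \<tau>X: "\<tau> ` X = (if e \<in> X then insert e (\<tau> ` ?X0) else \<tau> ` ?X0)"
    proof (cases "e \<in> X")
      case True
      then have "X = insert e ?X0" by blast
      then have "\<tau> ` X = insert (\<tau> e) (\<tau> ` ?X0)" by (metis image_insert)
      then show ?thesis using True \<tau>_e by simp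
    qed simp
    have "(B1 - X) \<union> \<tau> ` X = insert e ((A1 - ?X0) \<union> \<tau> ` ?X0)"
      "(B2 - \<tau> ` X) \<union> X = insert e ((A2 - \<tau> ` ?X0) \<union> ?X0)"
      unfolding \<tau>X B_eq using e_im no_e by auto
    then show ?thesis using main basisP by simp
  qed
  then have "k_exchange_ordering k ?P B1 B2 \<tau>" using bij unfolding k_exchange_ordering_def by blast
  then show ?thesis unfolding \<tau>_def .
qed

lemma k_base_orderable_principal_extension:
  assumes M: "k_base_orderable k M" and k: "k \<ge> 1" and e: "e \<notin> ground M" and F: "F \<subseteq> ground M"
  shows "k_base_orderable k (principal_extension M e F)" (is "k_base_orderable k ?P")
proof -
  note matM = k_base_orderable_matroid[OF M]
  note matP = matroid_principal_extension[OF matM e F]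
  note bas = bases_principal_extension[OF matM e F]
  have ord: "\<exists>\<sigma>. k_exchange_ordering k M A1 A2 \<sigma>" if "A1 \<in> bases M" "A2 \<in> bases M" for A1 A2
    using M that unfolding k_base_orderable_def by blast
  have lift: "B \<in> bases ?P" if "B \<in> bases M" for B
    using that bas basis_subset_ground[OF matM that] e by auto
  have one: "\<exists>\<sigma>. k_exchange_ordering k ?P B1 B2 \<sigma>"
    if B: "B1 \<in> bases ?P" "e \<in> B1" "B2 \<in> bases M" for B1 B2
  proof -
    obtain f where f: "f \<in> F - B1" "insert f (B1 - {e}) \<in> bases M" using B bas by metis
    then obtain \<sigma> where "k_exchange_ordering k M (insert f (B1 - {e})) B2 \<sigma>" using ord B(3) by blast
    then show ?thesis using exchange_ordering_principal_one[OF matM k e F B(2) f B(3)] by blast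
  qed
  have "\<exists>\<sigma>. k_exchange_ordering k ?P B1 B2 \<sigma>" if B: "B1 \<in> bases ?P" "B2 \<in> bases ?P" for B1 B2
  proof -
    consider "e \<in> B1" "e \<in> B2" | "e \<in> B1" "B2 \<in> bases M" | "B1 \<in> bases M" "e \<in> B2"
      | "B1 \<in> bases M" "B2 \<in> bases M"
      using B bas by metis
    then show ?thesis
    proof cases
      case 1
      obtain f1 where f1: "f1 \<in> F - B1" "insert f1 (B1 - {e}) \<in> bases M" using B 1 bas by metis
      obtain f2 where f2: "f2 \<in> F - B2" "insert f2 (B2 - {e}) \<in> bases M" using B 1 bas by metis
      obtain \<sigma> where "k_exchange_ordering k M (insert f1 (B1 - {e})) (insert f2 (B2 - {e})) \<sigma>"
        using ord f1 f2 by blast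
      then show ?thesis
        using exchange_ordering_principal_both[OF matM k e F 1(1) f1 1(2) f2] by blast
    next
      case 2
      then show ?thesis using one B by blast
    next
      case 3
      then obtain \<sigma> where "k_exchange_ordering k ?P B2 B1 \<sigma>" using one B by blast
      then show ?thesis using exchange_ordering_inverse basis_finite[OF matM 3(1)] by blast
    next
      case 4
      then obtain \<sigma> where "k_exchange_ordering k M B1 B2 \<sigma>" using ord by blast
      then have "k_exchange_ordering k ?P B1 B2 \<sigma>"
        using lift unfolding k_exchange_ordering_def by blast
      then show ?thesis by blast
    qed
  qed
  then show ?thesis using matP unfolding k_base_orderable_def by blast
qed

section \<open>Truncation\<close>

lemma rank_finite_set:
  assumes "finite Y" "matroid M"
  shows "rank M Y \<le> card Y" "rank M Y = card Y \<longleftrightarrow> Y \<in> indeps M"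
    "I \<in> indeps M \<Longrightarrow> I \<subseteq> Y \<Longrightarrow> card I \<le> rank M Y"
proof -
  let ?R = "{card I | I. I \<in> indeps M \<and> I \<subseteq> Y}"
  have R: "?R = card ` {I \<in> indeps M. I \<subseteq> Y}" by auto
  have fin: "finite ?R" unfolding R using finite_indeps[OF assms(2)] by simp
  have "?R \<noteq> {}" using indep_empty[OF assms(2)] by blast
  then have "Max ?R \<in> ?R" using fin Max_in by blast
  then obtain I0 where I0: "I0 \<in> indeps M" "I0 \<subseteq> Y" "card I0 = rank M Y"
    unfolding rank_def by force
  show le: "rank M Y \<le> card Y" using I0 card_mono[OF assms(1)] by metis
  show ge: "card I \<le> rank M Y" if "I \<in> indeps M" "I \<subseteq> Y" for I
    unfolding rank_def using fin that by (intro Max_ge) auto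
  show "rank M Y = card Y \<longleftrightarrow> Y \<in> indeps M"
  proof
    assume "rank M Y = card Y"
    then have "I0 = Y" using I0 card_subset_eq[OF assms(1)] by auto
    then show "Y \<in> indeps M" using I0 by simp
  next
    assume "Y \<in> indeps M"
    then show "rank M Y = card Y" using ge[of Y] le by simp
  qed
qed

text \<open>Both conditions on a set \<open>Y\<close> that contains \<open>e\<close> say that \<open>Y - {e}\<close> is independent but not a
basis: a non-spanning independent set is one that some element of the ground set enlarges.\<close>

lemma free_extension_eq_principal_extension:
  assumes M: "matroid M" and e: "e \<notin> ground M"
  shows "free_extension M e = principal_extension M e (ground M)"
proof -
  let ?E = "ground M"
  have finE: "finite ?E" using finite_ground[OF M] .
  have "Y \<in> indeps (free_extension M e) \<longleftrightarrow> Y \<in> indeps (principal_extension M e ?E)" for Y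
  proof (cases "Y \<subseteq> insert e ?E")
    case False
    then have "Y \<notin> indeps (free_extension M e)"
      by (simp add: free_extension_def matroid_of_rank_def)
    moreover have "Y \<notin> indeps (principal_extension M e ?E)"
      using False matroid_principal_extension[OF M e order_refl] indep_subset_ground by fastforce
    ultimately show ?thesis by simp
  next
    case True
    then have finY: "finite Y" using finE finite_subset by blast
    show ?thesis
    proof (cases "e \<in> Y")
      case False
      have "Y \<in> indeps (free_extension M e) \<longleftrightarrow> rank M Y = card Y"
        using True False by (simp add: free_extension_def matroid_of_rank_def)
      then show ?thesis using False rank_finite_set(2)[OF finY M] by (simp add: indeps_principal_extension)
    next
      case eY: True
      let ?Y0 = "Y - {e}"
      have fin0: "finite ?Y0" using finY by simp
      have sub0: "?Y0 \<subseteq> ?E" using True by blast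
      have cardY: "card Y = Suc (card ?Y0)" using card_Suc_Diff1[OF finY eY] by (rule sym)
      have "Y \<in> indeps (free_extension M e) \<longleftrightarrow> min (rank M ?Y0 + 1) (rank M ?E) = card Y"
        using True eY by (simp add: free_extension_def matroid_of_rank_def)
      also have "\<dots> \<longleftrightarrow> rank M ?Y0 = card ?Y0 \<and> card ?Y0 < rank M ?E"
        using cardY rank_finite_set(1)[OF fin0 M] by auto
      also have "\<dots> \<longleftrightarrow> ?Y0 \<in> indeps M \<and> card ?Y0 < rank M ?E"
        using rank_finite_set(2)[OF fin0 M] by simp
      also have "\<dots> \<longleftrightarrow> (\<exists>f\<in>?E - Y. insert f ?Y0 \<in> indeps M)"
      proof
        assume Y0: "?Y0 \<in> indeps M \<and> card ?Y0 < rank M ?E"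
        obtain B where B: "B \<in> bases M" using exists_basis[OF M] by blast
        have "card B = rank M ?E"
        proof -
          obtain B' where B': "B' \<in> indeps M" "card B' = rank M ?E"
          proof -
            have "rank M ?E \<in> {card I | I. I \<in> indeps M \<and> I \<subseteq> ?E}"
              unfolding rank_def
            proof (rule Max_in)
              have "{card I | I. I \<in> indeps M \<and> I \<subseteq> ?E} = card ` {I \<in> indeps M. I \<subseteq> ?E}" by auto
              then show "finite {card I | I. I \<in> indeps M \<and> I \<subseteq> ?E}" using finite_indeps[OF M] by simp
            qed (use indep_empty[OF M] in blast)
            then show thesis using that by auto
          qed
          then show ?thesis
            using card_indep_le_basis[OF M B B'(1)]
              rank_finite_set(3)[OF finE M basis_indep[OF B] basis_subset_ground[OF M B]] by simp
        qed
        then obtain f where f: "f \<in> B" "f \<notin> ?Y0" "insert f ?Y0 \<in> indeps M"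
          using Y0 indep_augment[OF M _ basis_indep[OF B], of ?Y0] by auto
        moreover have "f \<in> ?E" using f(1) basis_subset_ground[OF M B] by blast
        ultimately show "\<exists>f\<in>?E - Y. insert f ?Y0 \<in> indeps M" using e by blast
      next
        assume "\<exists>f\<in>?E - Y. insert f ?Y0 \<in> indeps M"
        then obtain f where f: "f \<in> ?E - Y" "insert f ?Y0 \<in> indeps M" by blast
        have "Suc (card ?Y0) \<le> rank M ?E"
          using rank_finite_set(3)[OF finE M f(2)] f(1) sub0 fin0 by simp
        moreover have "?Y0 \<in> indeps M" using indep_mono[OF M f(2)] by blast
        ultimately show "?Y0 \<in> indeps M \<and> card ?Y0 < rank M ?E" by simp
      qed
      finally show ?thesis using eY by (simp add: indeps_principal_extension)
    qed
  qed
  then have "indeps (free_extension M e) = indeps (principal_extension M e ?E)" by blast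
  moreover have "ground (free_extension M e) = ground (principal_extension M e ?E)"
    by (simp add: free_extension_def matroid_of_rank_def)
  ultimately show ?thesis by (intro pre_matroid.equality) auto
qed

lemma k_base_orderable_truncation:
  assumes "k_base_orderable k M" "k \<ge> 1" "e \<notin> ground M"
  shows "k_base_orderable k (truncation M e)"
proof -
  have "k_base_orderable k (free_extension M e)"
    using k_base_orderable_principal_extension[OF assms order_refl]
      free_extension_eq_principal_extension[OF k_base_orderable_matroid[OF assms(1)] assms(3)] by simp
  then show ?thesis unfolding truncation_def using assms(2) by (rule k_base_orderable_contract)
qed

section \<open>Bipartite induction\<close>

text \<open>\<open>M\<close> together with the elements of \<open>S\<close>, where each \<open>x \<in> S\<close> may be matched to an element of \<open>F x\<close>
and the elements of \<open>M\<close> are matched to themselves. Keeping the old elements makes it possible to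
add those of \<open>S\<close> one at a time.\<close>

definition bipartite_extension :: "'a pre_matroid \<Rightarrow> 'a set \<Rightarrow> ('a \<Rightarrow> 'a set) \<Rightarrow> 'a pre_matroid" where
  "bipartite_extension M S F =
     \<lparr>ground = ground M \<union> S,
      indeps = {I. I \<subseteq> ground M \<union> S \<and>
        (\<exists>g. inj_on g I \<and> (\<forall>x\<in>I. if x \<in> S then g x \<in> F x else g x = x) \<and> g ` I \<in> indeps M)}\<rparr>"

lemma bipartite_extension_empty:
  assumes "matroid M"
  shows "bipartite_extension M {} F = M"
proof -
  have "I \<in> indeps (bipartite_extension M {} F) \<longleftrightarrow> I \<in> indeps M" for I
  proof
    assume "I \<in> indeps (bipartite_extension M {} F)"
    then obtain g where "\<forall>x\<in>I. g x = x" "g ` I \<in> indeps M" by (auto simp: bipartite_extension_def)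
    then show "I \<in> indeps M" by simp
  next
    assume "I \<in> indeps M"
    then show "I \<in> indeps (bipartite_extension M {} F)"
      using indep_subset_ground[OF assms] by (auto simp: bipartite_extension_def intro!: exI[of _ id])
  qed
  then show ?thesis by (intro pre_matroid.equality) (auto simp: bipartite_extension_def)
qed

text \<open>The element \<open>f\<close> for which \<open>e\<close> stands is its partner in the matching. Since \<open>f\<close> is an old
element, the matching of \<open>(I - {e}) \<union> {f}\<close> must match it to itself, and so no other element of \<open>I\<close>
is matched to \<open>f\<close>.\<close>

lemma bipartite_extension_insert:
  assumes e: "e \<notin> S" "e \<notin> ground M" and S: "S \<inter> ground M = {}" and F: "F e \<subseteq> ground M"
  shows "bipartite_extension M (insert e S) F = principal_extension (bipartite_extension M S F) e (F e)"
    (is "?B = ?P")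
proof -
  have ind: "I \<in> indeps (bipartite_extension M T F) \<longleftrightarrow> I \<subseteq> ground M \<union> T \<and>
        (\<exists>g. inj_on g I \<and> (\<forall>x\<in>I. if x \<in> T then g x \<in> F x else g x = x) \<and> g ` I \<in> indeps M)" for I T
    by (simp add: bipartite_extension_def)
  have "I \<in> indeps ?B \<longleftrightarrow> I \<in> indeps ?P" for I
  proof (cases "e \<in> I")
    case False
    then have "(\<forall>x\<in>I. if x \<in> insert e S then g x \<in> F x else g x = x) \<longleftrightarrow>
               (\<forall>x\<in>I. if x \<in> S then g x \<in> F x else g x = x)" for g :: "'a \<Rightarrow> 'a" by auto
    then have "I \<in> indeps ?B \<longleftrightarrow> I \<in> indeps (bipartite_extension M S F)"
      unfolding ind using False by auto
    then show ?thesis using False by (simp add: indeps_principal_extension)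
  next
    case True
    show ?thesis
    proof
      assume "I \<in> indeps ?B"
      then obtain g where I: "I \<subseteq> ground M \<union> insert e S" and g: "inj_on g I" "g ` I \<in> indeps M"
        and gF: "\<forall>x\<in>I. if x \<in> insert e S then g x \<in> F x else g x = x"
        unfolding ind by blast
      define f where "f = g e"
      have fF: "f \<in> F e" using gF True by (auto simp: f_def)
      then have f: "f \<in> ground M" "f \<notin> insert e S" using F e S by auto
      have fI: "f \<notin> I"
      proof
        assume "f \<in> I"
        then have "g f = g e" using gF f by (auto simp: f_def)
        then have "f = e" using g(1) \<open>f \<in> I\<close> True inj_onD by metis
        then show False using f by blast
      qed
      let ?h = "g(f := f)" and ?I' = "insert f (I - {e})"
      have other: "?h x = g x" if "x \<in> I" for x using that fI by auto
      have "inj_on ?h ?I'"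
      proof (rule inj_onI)
        fix x y assume xy: "x \<in> ?I'" "y \<in> ?I'" "?h x = ?h y"
        have ne: "g z \<noteq> f" if "z \<in> I - {e}" for z
          using that g(1) True inj_onD[of g I z e] by (auto simp: f_def)
        show "x = y"
          using xy ne[of x] ne[of y] inj_onD[OF g(1), of x y] by (auto split: if_splits)
      qed
      moreover have "\<forall>x\<in>?I'. if x \<in> S then ?h x \<in> F x else ?h x = x"
        using gF f e(1) by auto
      moreover have "?h ` ?I' = g ` I"
      proof -
        have "?h ` ?I' = insert f (g ` (I - {e}))" using fI by auto
        also have "\<dots> = g ` I" using True by (auto simp: f_def)
        finally show ?thesis .
      qed
      moreover have "?I' \<subseteq> ground M \<union> S" using I f by blast
      ultimately have "?I' \<in> indeps (bipartite_extension M S F)" unfolding ind using g(2) by metis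
      then show "I \<in> indeps ?P" using True fF fI by (auto simp: indeps_principal_extension)
    next
      assume "I \<in> indeps ?P"
      then obtain f where f: "f \<in> F e" "f \<notin> I" and I': "insert f (I - {e}) \<in> indeps (bipartite_extension M S F)"
        using True by (auto simp: indeps_principal_extension)
      let ?I' = "insert f (I - {e})"
      obtain g where g: "inj_on g ?I'" "g ` ?I' \<in> indeps M"
        and gF: "\<forall>x\<in>?I'. if x \<in> S then g x \<in> F x else g x = x" and sub: "?I' \<subseteq> ground M \<union> S"
        using I' unfolding ind by blast
      have "f \<notin> S" using f(1) F S by blast
      then have gf: "g f = f" using gF by simp
      let ?h = "g(e := f)"
      have im: "?h ` I = g ` ?I'" using True gf by auto
      have "inj_on ?h I"
      proof (rule inj_onI)
        fix x y assume xy: "x \<in> I" "y \<in> I" "?h x = ?h y"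
        have ne: "g z \<noteq> f" if "z \<in> I" "z \<noteq> e" for z
          using that g(1) f(2) gf inj_onD[of g ?I' z f] by auto
        show "x = y"
          using xy ne[of x] ne[of y] inj_onD[OF g(1), of x y] by (auto split: if_splits)
      qed
      moreover have "\<forall>x\<in>I. if x \<in> insert e S then ?h x \<in> F x else ?h x = x"
        using gF f(1) by auto
      moreover have "I \<subseteq> ground M \<union> insert e S" using sub by blast
      ultimately show "I \<in> indeps ?B" unfolding ind using g(2) im by metis
    qed
  qed
  then show ?thesis by (intro pre_matroid.equality) (auto simp: bipartite_extension_def)
qed

lemma k_base_orderable_bipartite_extension:
  assumes M: "k_base_orderable k M" and k: "k \<ge> 1"
    and S: "finite S" "S \<inter> ground M = {}" "\<And>x. x \<in> S \<Longrightarrow> F x \<subseteq> ground M"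
  shows "k_base_orderable k (bipartite_extension M S F)"
  using S
proof (induction S rule: finite_induct)
  case empty
  then show ?case using M bipartite_extension_empty[OF k_base_orderable_matroid[OF M], of F] by simp
next
  case (insert e S)
  have "k_base_orderable k (bipartite_extension M S F)" using insert by auto
  moreover have "e \<notin> ground (bipartite_extension M S F)" "F e \<subseteq> ground (bipartite_extension M S F)"
    using insert by (auto simp: bipartite_extension_def)
  moreover have "bipartite_extension M (insert e S) F = principal_extension (bipartite_extension M S F) e (F e)"
    using insert by (intro bipartite_extension_insert) auto
  ultimately show ?case using k_base_orderable_principal_extension[OF _ k] by simp
qed

definition bipartite_induction :: "'a set \<Rightarrow> ('a \<Rightarrow> 'b set) \<Rightarrow> 'b pre_matroid \<Rightarrow> 'a pre_matroid" where
  "bipartite_induction S F M =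
     \<lparr>ground = S,
      indeps = {I. I \<subseteq> S \<and> (\<exists>g. inj_on g I \<and> (\<forall>x\<in>I. g x \<in> F x) \<and> g ` I \<in> indeps M)}\<rparr>"

lemma indeps_bipartite_induction:
  "I \<in> indeps (bipartite_induction S F M) \<longleftrightarrow>
     I \<subseteq> S \<and> (\<exists>g. inj_on g I \<and> (\<forall>x\<in>I. g x \<in> F x) \<and> g ` I \<in> indeps M)"
  by (simp add: bipartite_induction_def)

text \<open>The sum type makes \<open>S\<close> disjoint from the ground set of \<open>M\<close>, as the bipartite extension requires.
There it only remains to delete the copy of \<open>M\<close>.\<close>

lemma k_base_orderable_bipartite_induction:
  fixes M :: "'b pre_matroid" and S :: "'a set"
  assumes M: "k_base_orderable k M" and k: "k \<ge> 1"
    and S: "finite S" and F: "\<And>x. x \<in> S \<Longrightarrow> F x \<subseteq> ground M"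
  shows "k_base_orderable k (bipartite_induction S F M)"
proof -
  note matM = k_base_orderable_matroid[OF M]
  define M1 :: "('a + 'b) pre_matroid" where
    "M1 = \<lparr>ground = Inr ` ground M, indeps = (`) Inr ` indeps M\<rparr>"
  define G :: "'a + 'b \<Rightarrow> ('a + 'b) set" where "G = (\<lambda>x. Inr ` F (projl x))"
  define M3 where "M3 = delete (bipartite_extension M1 (Inl ` S) G) (Inr ` ground M)"
  have ind1: "Inr ` X \<in> indeps M1 \<longleftrightarrow> X \<in> indeps M" for X
    by (auto simp: M1_def inj_image_eq_iff)
  have iso1: "isomorphic M M1"
    unfolding isomorphic_def using ind1
    by (intro exI[of _ Inr]) (auto simp: M1_def intro: bij_betw_imageI)
  have "I \<subseteq> ground M1" if "I \<in> indeps M1" for I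
    using that indep_subset_ground[OF matM] by (auto simp: M1_def)
  then have "k_base_orderable k M1"
    using k_base_orderable_isomorphic[OF M _ iso1] matroid_isomorphic[OF matM iso1] by blast
  moreover have "G x \<subseteq> ground M1" if "x \<in> Inl ` S" for x
    using that F by (fastforce simp: G_def M1_def)
  moreover have "Inl ` S \<inter> ground M1 = {}" by (auto simp: M1_def)
  ultimately have M3: "k_base_orderable k M3"
    unfolding M3_def using k S
    by (intro k_base_orderable_delete k_base_orderable_bipartite_extension) auto
  have ground3: "ground M3 = Inl ` S" by (auto simp: M3_def delete_def bipartite_extension_def M1_def)
  have ind3: "Inl ` Y \<in> indeps M3 \<longleftrightarrow> Y \<in> indeps (bipartite_induction S F M)" if Y: "Y \<subseteq> S" for Y
  proof -
    have "Inl ` Y \<subseteq> ground M1 \<union> Inl ` S" "Inl ` Y \<inter> Inr ` ground M = {}" using Y by auto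
    moreover have "(\<forall>x\<in>Inl ` Y. if x \<in> Inl ` S then g x \<in> G x else g x = x) \<longleftrightarrow>
        (\<forall>y\<in>Y. g (Inl y) \<in> Inr ` F y)" for g :: "'a + 'b \<Rightarrow> 'a + 'b"
      using Y by (auto simp: G_def)
    ultimately have "Inl ` Y \<in> indeps M3 \<longleftrightarrow>
      (\<exists>g :: 'a + 'b \<Rightarrow> 'a + 'b. inj_on g (Inl ` Y) \<and> (\<forall>y\<in>Y. g (Inl y) \<in> Inr ` F y) \<and> g ` Inl ` Y \<in> indeps M1)"
      by (simp add: M3_def delete_def bipartite_extension_def)
    also have "\<dots> \<longleftrightarrow> (\<exists>h. inj_on h Y \<and> (\<forall>y\<in>Y. h y \<in> F y) \<and> h ` Y \<in> indeps M)"
    proof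
      assume "\<exists>g :: 'a + 'b \<Rightarrow> 'a + 'b. inj_on g (Inl ` Y) \<and> (\<forall>y\<in>Y. g (Inl y) \<in> Inr ` F y) \<and> g ` Inl ` Y \<in> indeps M1"
      then obtain g :: "'a + 'b \<Rightarrow> 'a + 'b" where g: "inj_on g (Inl ` Y)" "\<forall>y\<in>Y. g (Inl y) \<in> Inr ` F y" "g ` Inl ` Y \<in> indeps M1"
        by blast
      define h where "h y = projr (g (Inl y))" for y
      have gh: "g (Inl y) = Inr (h y)" "h y \<in> F y" if "y \<in> Y" for y
        using g(2) that by (auto simp: h_def)
      have "inj_on h Y"
      proof (rule inj_onI)
        fix x y assume "x \<in> Y" "y \<in> Y" "h x = h y"
        then show "x = y" using gh(1)[of x] gh(1)[of y] inj_onD[OF g(1), of "Inl x" "Inl y"] by simp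
      qed
      moreover have "g ` Inl ` Y = Inr ` h ` Y" using gh(1) by (force simp: image_image)
      then have "h ` Y \<in> indeps M" using g(3) ind1 by simp
      ultimately show "\<exists>h. inj_on h Y \<and> (\<forall>y\<in>Y. h y \<in> F y) \<and> h ` Y \<in> indeps M" using gh(2) by blast
    next
      assume "\<exists>h. inj_on h Y \<and> (\<forall>y\<in>Y. h y \<in> F y) \<and> h ` Y \<in> indeps M"
      then obtain h where h: "inj_on h Y" "\<forall>y\<in>Y. h y \<in> F y" "h ` Y \<in> indeps M" by blast
      let ?g = "\<lambda>x :: 'a + 'b. Inr (h (projl x)) :: 'a + 'b"
      have "?g ` Inl ` Y = Inr ` h ` Y" by (simp add: image_image)
      then have "?g ` Inl ` Y \<in> indeps M1" using h(3) ind1 by simp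
      moreover have "inj_on ?g (Inl ` Y)" using h(1) by (auto simp: inj_on_def)
      ultimately show "\<exists>g :: 'a + 'b \<Rightarrow> 'a + 'b. inj_on g (Inl ` Y) \<and> (\<forall>y\<in>Y. g (Inl y) \<in> Inr ` F y) \<and> g ` Inl ` Y \<in> indeps M1"
        using h(2) by (intro exI[of _ ?g]) auto
    qed
    finally show ?thesis using Y by (simp add: indeps_bipartite_induction)
  qed
  have "isomorphic M3 (bipartite_induction S F M)"
    unfolding isomorphic_def
  proof (intro exI[of _ projl] conjI allI impI)
    show "bij_betw projl (ground M3) (ground (bipartite_induction S F M))"
      unfolding ground3 by (rule bij_betw_imageI) (auto simp: inj_on_def bipartite_induction_def image_image)
    fix X assume "X \<subseteq> ground M3"
    then obtain Y where Y: "Y \<subseteq> S" "X = Inl ` Y" unfolding ground3 using subset_imageE by metis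
    then have "projl ` X = Y" by (simp add: image_image)
    then show "X \<in> indeps M3 \<longleftrightarrow> projl ` X \<in> indeps (bipartite_induction S F M)" using ind3 Y by simp
  qed
  moreover have "I \<subseteq> ground (bipartite_induction S F M)" if "I \<in> indeps (bipartite_induction S F M)" for I
    using that by (simp add: bipartite_induction_def)
  ultimately show ?thesis
    using k_base_orderable_isomorphic[OF M3] matroid_isomorphic[OF k_base_orderable_matroid[OF M3]] by blast
qed

section \<open>Linkings and successor functions\<close>

text \<open>The map \<open>s\<close> sends each vertex of the path to the next one.\<close>

lemma path_successor:
  assumes wf: "pair_wf_digraph \<Gamma>" and p: "pre_digraph.apath (with_proj \<Gamma>) u p v"
  obtains s where "u \<in> path_verts \<Gamma> (u, p, v)" "v \<in> path_verts \<Gamma> (u, p, v)"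
    "path_verts \<Gamma> (u, p, v) \<subseteq> pverts \<Gamma>"
    "inj_on s (path_verts \<Gamma> (u, p, v) - {v})"
    "s ` (path_verts \<Gamma> (u, p, v) - {v}) \<subseteq> path_verts \<Gamma> (u, p, v) - {u}"
    "\<And>x. x \<in> path_verts \<Gamma> (u, p, v) - {v} \<Longrightarrow> (x, s x) \<in> parcs \<Gamma>"
proof -
  interpret pair_wf_digraph \<Gamma> by fact
  have "\<exists>s. u \<in> path_verts \<Gamma> (u, p, v) \<and> v \<in> path_verts \<Gamma> (u, p, v) \<and>
    path_verts \<Gamma> (u, p, v) \<subseteq> pverts \<Gamma> \<and>
    inj_on s (path_verts \<Gamma> (u, p, v) - {v}) \<and>
    s ` (path_verts \<Gamma> (u, p, v) - {v}) \<subseteq> path_verts \<Gamma> (u, p, v) - {u} \<and>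
    (\<forall>x\<in>path_verts \<Gamma> (u, p, v) - {v}. (x, s x) \<in> parcs \<Gamma>)"
    using p
  proof (induction p arbitrary: u)
    case Nil
    then have "u = v" "u \<in> pverts \<Gamma>" by (auto simp: apath_Nil_iff)
    then show ?case by (simp add: path_verts_def)
  next
    case (Cons a p)
    let ?w = "snd a" and ?P = "path_verts \<Gamma> (u, a # p, v)" and ?Q = "path_verts \<Gamma> (snd a, p, v)"
    have a: "a \<in> parcs \<Gamma>" "fst a = u" "u \<notin> ?Q" and tl: "apath ?w p v"
      using Cons.prems unfolding apath_Cons_iff by (auto simp: path_verts_def)
    have P: "?P = insert u ?Q" using a(2) by (simp add: path_verts_def)
    obtain s where s: "?w \<in> ?Q" "v \<in> ?Q" "?Q \<subseteq> pverts \<Gamma>" "inj_on s (?Q - {v})"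
      "s ` (?Q - {v}) \<subseteq> ?Q - {?w}" "\<forall>x\<in>?Q - {v}. (x, s x) \<in> parcs \<Gamma>"
      using Cons.IH[OF tl] by blast
    let ?t = "s(u := ?w)"
    have dom: "?P - {v} = insert u (?Q - {v})" using a(3) s(2) unfolding P by auto
    have t_simps: "?t u = ?w" "?t ` (?Q - {v}) = s ` (?Q - {v})" using a(3) by auto
    have "inj_on ?t (?Q - {v}) \<longleftrightarrow> inj_on s (?Q - {v})" by (rule inj_on_cong) (use a(3) in auto)
    then have "inj_on ?t (?Q - {v})" using s(4) by blast
    then have "inj_on ?t (?P - {v})"
      unfolding dom inj_on_insert using t_simps s(5) a(3) by auto
    moreover have "?t ` (?P - {v}) \<subseteq> ?P - {u}"
      unfolding dom image_insert t_simps using s(1,5) a(3) unfolding P by auto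
    moreover have "(x, ?t x) \<in> parcs \<Gamma>" if "x \<in> ?P - {v}" for x
    proof (cases "x = u")
      case True
      then show ?thesis using a by (metis fun_upd_same prod.collapse)
    next
      case False
      then show ?thesis using that s(6) unfolding dom by simp
    qed
    moreover have "u \<in> pverts \<Gamma>" using a(1,2) in_arcsD1[of u ?w] by (metis prod.collapse)
    ultimately show ?case using s(2,3) unfolding P by blast
  qed
  then show thesis using that by blast
qed

text \<open>Move each vertex to the next one on its path, and fix the vertices that lie on no path. The map
is undefined only at the terminal vertices \<open>Z\<close>, and it misses exactly the initial vertices \<open>W\<close>.\<close>

lemma successor_of_linkage:
  assumes wf: "pair_wf_digraph \<Gamma>" and linked: "linked \<Gamma> W Z"
  obtains s where "inj_on s (pverts \<Gamma> - Z)" "s ` (pverts \<Gamma> - Z) \<subseteq> pverts \<Gamma> - W"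
    "\<And>x. x \<in> pverts \<Gamma> - Z \<Longrightarrow> s x = x \<or> (x, s x) \<in> parcs \<Gamma>"
proof -
  let ?V = "pverts \<Gamma>"
  obtain P where P: "\<forall>(u, p, v)\<in>P. pre_digraph.apath (with_proj \<Gamma>) u p v"
    and disj: "disjoint_family_on (path_verts \<Gamma>) P"
    and W: "(\<lambda>(u, p, v). u) ` P = W" and Z: "(\<lambda>(u, p, v). v) ` P = Z"
    using linked unfolding linked_def by blast
  define first_vert where "first_vert = (\<lambda>(u, p :: ('a \<times> 'a) list, v :: 'a). u :: 'a)"
  define last_vert where "last_vert = (\<lambda>(u :: 'a, p :: ('a \<times> 'a) list, v). v :: 'a)"
  define succ_on where "succ_on q t \<longleftrightarrow>
    first_vert q \<in> path_verts \<Gamma> q \<and> path_verts \<Gamma> q \<subseteq> ?V \<and>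
    inj_on t (path_verts \<Gamma> q - {last_vert q}) \<and>
    t ` (path_verts \<Gamma> q - {last_vert q}) \<subseteq> path_verts \<Gamma> q - {first_vert q} \<and>
    (\<forall>x\<in>path_verts \<Gamma> q - {last_vert q}. (x, t x) \<in> parcs \<Gamma>)" for q t
  have "\<forall>q\<in>P. \<exists>t. succ_on q t"
  proof
    fix q assume q: "q \<in> P"
    obtain u p v where upv: "q = (u, p, v)" by (cases q)
    then have "pre_digraph.apath (with_proj \<Gamma>) u p v" using P q by auto
    from path_successor[OF wf this] show "\<exists>t. succ_on q t"
      unfolding succ_on_def upv first_vert_def last_vert_def prod.case by metis
  qed
  from bchoice[OF this] obtain S where "\<forall>q\<in>P. succ_on q (S q)" by blast
  then have S: "\<And>q. q \<in> P \<Longrightarrow> first_vert q \<in> path_verts \<Gamma> q"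
      "\<And>q. q \<in> P \<Longrightarrow> path_verts \<Gamma> q \<subseteq> ?V"
      "\<And>q. q \<in> P \<Longrightarrow> inj_on (S q) (path_verts \<Gamma> q - {last_vert q})"
      "\<And>q. q \<in> P \<Longrightarrow> S q ` (path_verts \<Gamma> q - {last_vert q}) \<subseteq> path_verts \<Gamma> q - {first_vert q}"
      "\<And>q x. q \<in> P \<Longrightarrow> x \<in> path_verts \<Gamma> q - {last_vert q} \<Longrightarrow> (x, S q x) \<in> parcs \<Gamma>"
    unfolding succ_on_def by simp_all
  have uniq: "q = q'" if "q \<in> P" "q' \<in> P" "x \<in> path_verts \<Gamma> q" "x \<in> path_verts \<Gamma> q'" for q q' x
    using disj that unfolding disjoint_family_on_def by blast
  define s where "s x = (if \<exists>q\<in>P. x \<in> path_verts \<Gamma> q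
      then S (SOME q. q \<in> P \<and> x \<in> path_verts \<Gamma> q) x else x)" for x
  have s_on: "s x = S q x" if q: "q \<in> P" "x \<in> path_verts \<Gamma> q" for q x
  proof -
    have "(SOME q. q \<in> P \<and> x \<in> path_verts \<Gamma> q) = q"
      by (rule some_equality) (use q uniq in blast)+
    then show ?thesis using q by (auto simp: s_def)
  qed
  have s_off: "s x = x" if "\<not> (\<exists>q\<in>P. x \<in> path_verts \<Gamma> q)" for x using that by (simp add: s_def)
  have inner: "x \<in> path_verts \<Gamma> q - {last_vert q}" if "q \<in> P" "x \<in> path_verts \<Gamma> q" "x \<notin> Z" for x q
    using that Z unfolding last_vert_def by blast
  have s_path: "s x \<in> path_verts \<Gamma> q - {first_vert q}" if "q \<in> P" "x \<in> path_verts \<Gamma> q" "x \<notin> Z" for x q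
    using S(4)[OF that(1)] inner[OF that] s_on[OF that(1,2)] by auto
  have stays: "(\<exists>q\<in>P. s x \<in> path_verts \<Gamma> q) \<longleftrightarrow> (\<exists>q\<in>P. x \<in> path_verts \<Gamma> q)" if "x \<notin> Z" for x
    using s_path[of _ x] s_off[of x] that by force
  have "inj_on s (?V - Z)"
  proof (rule inj_onI)
    fix x y assume x: "x \<in> ?V - Z" and y: "y \<in> ?V - Z" and eq: "s x = s y"
    show "x = y"
    proof (cases "\<exists>q\<in>P. x \<in> path_verts \<Gamma> q")
      case True
      then obtain q q' where q: "q \<in> P" "x \<in> path_verts \<Gamma> q" and q': "q' \<in> P" "y \<in> path_verts \<Gamma> q'"
        using stays[of x] stays[of y] x y eq by auto
      have "s x \<in> path_verts \<Gamma> q" "s x \<in> path_verts \<Gamma> q'"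
        using s_path[OF q] s_path[OF q'] x y eq by auto
      then have "q' = q" using uniq q(1) q'(1) by blast
      then show ?thesis
        using inj_onD[OF S(3)[OF q(1)], of x y] inner[OF q] inner[OF q'] s_on[OF q] s_on[OF q'] x y eq
        by auto
    next
      case False
      then have "\<not> (\<exists>q\<in>P. y \<in> path_verts \<Gamma> q)" using stays[of x] stays[of y] x y eq by auto
      then show ?thesis using s_off False eq by metis
    qed
  qed
  moreover have "s ` (?V - Z) \<subseteq> ?V - W"
  proof
    fix y assume "y \<in> s ` (?V - Z)"
    then obtain x where x: "x \<in> ?V - Z" "y = s x" by blast
    show "y \<in> ?V - W"
    proof (cases "\<exists>q\<in>P. x \<in> path_verts \<Gamma> q")
      case True
      then obtain q where q: "q \<in> P" "x \<in> path_verts \<Gamma> q" by blast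
      have y: "y \<in> path_verts \<Gamma> q" "y \<noteq> first_vert q" using s_path[OF q] x by auto
      have "y \<noteq> first_vert q'" if "q' \<in> P" for q'
        using uniq[OF q(1) that y(1)] S(1)[OF that] y(2) by auto
      then have "y \<notin> W" using W unfolding first_vert_def by auto
      then show ?thesis using y S(2)[OF q(1)] by blast
    next
      case False
      then have "y = x" using s_off x by simp
      moreover have "x \<notin> W"
      proof
        assume "x \<in> W"
        then obtain q where "q \<in> P" "x = first_vert q" using W unfolding first_vert_def by auto
        then show False using False S(1) by blast
      qed
      ultimately show ?thesis using x by blast
    qed
  qed
  moreover have "s x = x \<or> (x, s x) \<in> parcs \<Gamma>" if "x \<in> ?V - Z" for x
    using S(5) inner s_on s_off that by (metis DiffD2)
  ultimately show thesis using that by blast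
qed

lemma awalk_of_sequence:
  "pre_digraph.awalk_verts (with_proj \<Gamma>) (f 0) (map (\<lambda>i. (f i, f (Suc i))) [0..<n]) = map f [0..<Suc n]"
  "pre_digraph.cas (with_proj \<Gamma>) (f 0) (map (\<lambda>i. (f i, f (Suc i))) [0..<n]) (f n)"
proof (induction n arbitrary: f)
  case 0
  { case 1 then show ?case by (simp add: pre_digraph.awalk_verts.simps) }
  { case 2 then show ?case by (simp add: pre_digraph.cas.simps) }
next
  case (Suc n)
  have shift: "map g [0..<Suc m] = g 0 # map (g \<circ> Suc) [0..<m]" for g :: "nat \<Rightarrow> 'b" and m
    by (metis map_map map_Suc_upt list.simps(9) upt_conv_Cons zero_less_Suc)
  have arcs: "map (\<lambda>i. (f i, f (Suc i))) [0..<Suc n] =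
      (f 0, (f \<circ> Suc) 0) # map (\<lambda>i. ((f \<circ> Suc) i, (f \<circ> Suc) (Suc i))) [0..<n]" for f :: "nat \<Rightarrow> 'a"
    unfolding shift by (simp add: comp_def)
  { case 1 show ?case
      unfolding arcs shift[of f "Suc n"] using Suc(1)[of "f \<circ> Suc"]
      by (simp add: pre_digraph.awalk_verts.simps del: upt_Suc comp_apply) }
  { case 2 show ?case
      unfolding arcs using Suc(2)[of "f \<circ> Suc"]
      by (simp add: pre_digraph.cas.simps del: upt_Suc) }
qed

text \<open>Follow \<open>s\<close> from each \<open>w \<in> W\<close> until \<open>Z0\<close> is reached. Two equal vertices on such orbits can be traced
back, \<open>s\<close> being injective, until one of them is a starting point. As the image of \<open>s\<close> avoids \<open>W\<close>,
the other one is then the same starting point, after the same number of steps. So the orbits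
never repeat a vertex, they stop because the vertex set is finite, and they are disjoint.\<close>

lemma linkage_of_successor:
  assumes fin: "finite (pverts \<Gamma>)" and W: "W \<subseteq> pverts \<Gamma>"
    and inj: "inj_on s (pverts \<Gamma> - Z0)" and into: "s ` (pverts \<Gamma> - Z0) \<subseteq> pverts \<Gamma> - W"
    and step: "\<And>x. x \<in> pverts \<Gamma> - Z0 \<Longrightarrow> s x = x \<or> (x, s x) \<in> parcs \<Gamma>"
  obtains Z where "Z \<subseteq> Z0" "linked \<Gamma> W Z"
proof -
  let ?V = "pverts \<Gamma>"
  have cancel: "i = j \<and> w = w'"
    if "w \<in> W" "w' \<in> W" "\<forall>m<i. (s ^^ m) w \<in> ?V - Z0" "\<forall>m<j. (s ^^ m) w' \<in> ?V - Z0"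
      "(s ^^ i) w = (s ^^ j) w'" for w w' i j
    using that
  proof (induction i arbitrary: j)
    case 0
    show ?case
    proof (cases j)
      case (Suc m)
      then have "w \<in> s ` (?V - Z0)" using 0 by auto
      then show ?thesis using into 0 by blast
    qed (use 0 in simp)
  next
    case (Suc i)
    show ?case
    proof (cases j)
      case 0
      then have "w' \<in> s ` (?V - Z0)" using Suc.prems(3,5) by (metis funpow.simps(2) comp_apply funpow_0 image_eqI lessI)
      then show ?thesis using into Suc.prems by blast
    next
      case j: (Suc m)
      have "(s ^^ i) w \<in> ?V - Z0" "(s ^^ m) w' \<in> ?V - Z0" using Suc.prems(3,4) j by auto
      moreover have "s ((s ^^ i) w) = s ((s ^^ m) w')" using Suc.prems(5) j by simp
      ultimately have "(s ^^ i) w = (s ^^ m) w'" using inj inj_onD by metis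
      then have "i = m \<and> w = w'" using Suc.IH[of m] Suc.prems j by auto
      then show ?thesis using j by simp
    qed
  qed
  have in_V: "(s ^^ i) w \<in> ?V" if "w \<in> W" "\<forall>m<i. (s ^^ m) w \<in> ?V - Z0" for w i
    using that W into by (cases i) auto
  have reach: "\<exists>i. (s ^^ i) w \<in> Z0" if w: "w \<in> W" for w
  proof (rule ccontr)
    assume none: "\<not> (\<exists>i. (s ^^ i) w \<in> Z0)"
    have all: "\<forall>m<i. (s ^^ m) w \<in> ?V - Z0" for i
    proof (induction i)
      case (Suc i)
      then show ?case using in_V[OF w Suc] none less_Suc_eq by auto
    qed simp
    have "inj (\<lambda>i. (s ^^ i) w)"
      using cancel[OF w w all all] by (auto intro: injI)
    moreover have "range (\<lambda>i. (s ^^ i) w) \<subseteq> ?V" using in_V[OF w all] by auto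
    ultimately show False using fin by (meson finite_imageD finite_subset infinite_UNIV_nat)
  qed
  define n where "n w = (LEAST i. (s ^^ i) w \<in> Z0)" for w
  have end_Z0: "(s ^^ n w) w \<in> Z0" if "w \<in> W" for w
    using reach[OF that] unfolding n_def by (rule LeastI_ex)
  have before: "\<forall>m<i. (s ^^ m) w \<in> ?V - Z0" if w: "w \<in> W" and "i \<le> n w" for w i
    using that(2)
  proof (induction i)
    case (Suc i)
    then have "(s ^^ i) w \<in> ?V" using in_V[OF w] by simp
    moreover have "(s ^^ i) w \<notin> Z0" using not_less_Least Suc.prems unfolding n_def by (metis Suc_le_lessD)
    ultimately show ?case using Suc less_Suc_eq by auto
  qed simp
  define path where "path w = map (\<lambda>i. ((s ^^ i) w, (s ^^ Suc i) w)) [0..<n w]" for w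
  define route where "route w = (w, path w, (s ^^ n w) w)" for w
  have verts_list: "pre_digraph.awalk_verts (with_proj \<Gamma>) w (path w) = map (\<lambda>i. (s ^^ i) w) [0..<Suc (n w)]" for w
    using awalk_of_sequence(1)[of \<Gamma> "\<lambda>i. (s ^^ i) w" "n w"] unfolding path_def by simp
  have verts: "path_verts \<Gamma> (route w) = (\<lambda>i. (s ^^ i) w) ` {..n w}" for w
    unfolding path_verts_def route_def prod.case verts_list
    by (simp add: atLeast0LessThan lessThan_Suc_atMost del: upt_Suc)
  have apath: "pre_digraph.apath (with_proj \<Gamma>) w (path w) ((s ^^ n w) w)" if w: "w \<in> W" for w
  proof -
    have "((s ^^ i) w, (s ^^ Suc i) w) \<in> parcs \<Gamma>" if i: "i < n w" for i
    proof -
      have "(s ^^ i) w \<noteq> (s ^^ Suc i) w" using cancel[OF w w before before, of i "Suc i"] w i by auto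
      moreover have "(s ^^ i) w \<in> ?V - Z0" using before[OF w order_refl] i by blast
      ultimately show ?thesis using step by fastforce
    qed
    then have "set (path w) \<subseteq> parcs \<Gamma>" unfolding path_def by auto
    moreover have "pre_digraph.cas (with_proj \<Gamma>) w (path w) ((s ^^ n w) w)"
      using awalk_of_sequence(2)[of \<Gamma> "\<lambda>i. (s ^^ i) w" "n w"] unfolding path_def by simp
    moreover have "inj_on (\<lambda>i. (s ^^ i) w) {..n w}"
      using cancel[OF w w before before] w by (intro inj_onI) blast
    then have "distinct (pre_digraph.awalk_verts (with_proj \<Gamma>) w (path w))"
      unfolding verts_list distinct_map
      by (simp add: atLeast0LessThan lessThan_Suc_atMost del: upt_Suc)
    ultimately show ?thesis
      using w W unfolding pre_digraph.apath_def pre_digraph.awalk_def by auto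
  qed
  let ?Z = "(\<lambda>w. (s ^^ n w) w) ` W" and ?P = "route ` W"
  have finW: "finite W" using W fin finite_subset by blast
  have "inj_on (\<lambda>w. (s ^^ n w) w) W"
    using cancel before by (intro inj_onI) (metis order_refl)
  then have "card W = card ?Z" by (simp add: card_image)
  moreover have "card ?P = card W" by (rule card_image) (auto simp: inj_on_def route_def)
  moreover have "\<forall>(u, p, v)\<in>?P. pre_digraph.apath (with_proj \<Gamma>) u p v"
    using apath by (auto simp: route_def)
  moreover have "disjoint_family_on (path_verts \<Gamma>) ?P"
    unfolding disjoint_family_on_def
  proof (intro ballI impI)
    fix q q' assume "q \<in> ?P" "q' \<in> ?P" "q \<noteq> q'"
    then obtain w w' where w: "w \<in> W" "w' \<in> W" "w \<noteq> w'" "q = route w" "q' = route w'" by blast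
    show "path_verts \<Gamma> q \<inter> path_verts \<Gamma> q' = {}"
    proof (rule ccontr)
      assume "path_verts \<Gamma> q \<inter> path_verts \<Gamma> q' \<noteq> {}"
      then obtain i j where "i \<le> n w" "j \<le> n w'" "(s ^^ i) w = (s ^^ j) w'"
        unfolding w verts by auto
      then show False using cancel[OF w(1,2) before before] w by blast
    qed
  qed
  moreover have "(\<lambda>(u, p, v). u) ` ?P = W" "(\<lambda>(u, p, v). v) ` ?P = ?Z"
    by (auto simp: route_def image_image)
  ultimately have "linked \<Gamma> W ?Z" unfolding linked_def using finW by blast
  moreover have "?Z \<subseteq> Z0" using end_Z0 by blast
  ultimately show thesis using that by blast
qed

section \<open>Induction by directed graphs and completeness\<close>

text \<open>The elements of \<open>V\<close> outside the ground set become loops, so this is meant for \<open>V\<close> containing it.\<close>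

definition enlarge_ground :: "'a pre_matroid \<Rightarrow> 'a set \<Rightarrow> 'a pre_matroid" where
  "enlarge_ground M V = \<lparr>ground = V, indeps = indeps M\<rparr>"

lemma enlarge_ground_simps [simp]:
  "ground (enlarge_ground M V) = V" "indeps (enlarge_ground M V) = indeps M"
  "bases (enlarge_ground M V) = bases M"
  by (auto simp: enlarge_ground_def bases_def)

lemma k_base_orderable_enlarge_ground:
  assumes "k_base_orderable k M" "ground M \<subseteq> V" "finite V"
  shows "k_base_orderable k (enlarge_ground M V)"
proof -
  have "matroid (enlarge_ground M V)"
    using k_base_orderable_matroid[OF assms(1)] assms(2,3) unfolding matroid_def by auto
  then show ?thesis using assms(1) by (simp add: k_base_orderable_def k_exchange_ordering_def)
qed

text \<open>A linking of \<open>W\<close> to a basis \<open>Z\<close> of \<open>M\<close> amounts to an injective successor function from \<open>V - Z\<close>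
into \<open>V - W\<close>, which is a matching of a subset of \<open>V - W\<close> onto a basis of the dual of \<open>M\<close> (with the
vertices outside \<open>M\<close> added as loops). Thus \<open>W\<close> is independent in the induced matroid exactly if
\<open>V - W\<close> contains a basis of the matroid \<open>Q\<close> induced from that dual by the bipartite graph in which
\<open>y\<close> is joined to \<open>y\<close> and to its in-neighbours: the induced matroid is the dual of \<open>Q\<close>.\<close>

lemma k_base_orderable_induced_matroid:
  assumes M: "k_base_orderable k M" and k: "k \<ge> 1"
    and \<Gamma>: "pair_fin_digraph \<Gamma>" and sub: "ground M \<subseteq> pverts \<Gamma>"
  shows "k_base_orderable k (induced_matroid \<Gamma> M)"
proof -
  interpret pair_fin_digraph \<Gamma> by fact
  have wf: "pair_wf_digraph \<Gamma>" ..
  let ?V = "pverts \<Gamma>"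
  let ?N = "enlarge_ground M ?V"
  define F where "F y = {x \<in> ?V. x = y \<or> (x, y) \<in> parcs \<Gamma>}" for y
  define Q where "Q = bipartite_induction ?V F (dual ?N)"
  have finV: "finite ?V" by simp
  note matM = k_base_orderable_matroid[OF M]
  have N: "k_base_orderable k ?N" using k_base_orderable_enlarge_ground[OF M sub finV] .
  note matN = k_base_orderable_matroid[OF N]
  note matD = matroid_dual[OF matN]
  have Q: "k_base_orderable k Q"
    unfolding Q_def using k_base_orderable_dual[OF N k] k finV
    by (rule k_base_orderable_bipartite_induction) (auto simp: F_def)
  note matQ = k_base_orderable_matroid[OF Q]
  have basD: "B \<in> bases (dual ?N) \<longleftrightarrow> B \<subseteq> ?V \<and> ?V - B \<in> bases M" for B
    using bases_dual[OF matN] by simp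
  have cobasis: "?V - Z \<in> bases (dual ?N)" if "Z \<in> bases M" for Z
  proof -
    have "Z \<subseteq> ?V" using basis_subset_ground[OF matM that] sub by blast
    then show ?thesis using that by (simp add: basD double_diff)
  qed
  have indQ: "I \<in> indeps Q \<longleftrightarrow>
      I \<subseteq> ?V \<and> (\<exists>g. inj_on g I \<and> (\<forall>y\<in>I. g y \<in> F y) \<and> g ` I \<in> indeps (dual ?N))" for I
    unfolding Q_def by (rule indeps_bipartite_induction)
  obtain Z0 where Z0: "Z0 \<in> bases M" using exists_basis[OF matM] by blast
  have "?V - Z0 \<in> indeps Q"
    unfolding indQ using basis_indep[OF cobasis[OF Z0]]
    by (intro conjI exI[of _ id]) (auto simp: F_def)
  moreover have "card I \<le> card (?V - Z0)" if "I \<in> indeps Q" for I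
  proof -
    obtain g where g: "inj_on g I" "g ` I \<in> indeps (dual ?N)" using \<open>I \<in> indeps Q\<close> unfolding indQ by blast
    have "card (g ` I) \<le> card (?V - Z0)" using card_indep_le_basis[OF matD cobasis[OF Z0] g(2)] .
    then show ?thesis using card_image[OF g(1)] by simp
  qed
  ultimately have "?V - Z0 \<in> bases Q" using basisI_card[OF matQ] by blast
  note basQ = basis_iff_card[OF matQ this]

  have "W \<in> indeps (induced_matroid \<Gamma> M) \<longleftrightarrow> W \<in> indeps (dual Q)" for W
  proof
    assume "W \<in> indeps (induced_matroid \<Gamma> M)"
    then obtain Z where W: "W \<subseteq> ?V" and Z: "Z \<in> indeps M" "linked \<Gamma> W Z"
      by (auto simp: induced_matroid_def)
    obtain Z1 where Z1: "Z1 \<in> bases M" "Z \<subseteq> Z1" using extend_to_basis[OF matM Z(1)] by blast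
    obtain s where s: "inj_on s (?V - Z)" "s ` (?V - Z) \<subseteq> ?V - W"
      "\<And>x. x \<in> ?V - Z \<Longrightarrow> s x = x \<or> (x, s x) \<in> parcs \<Gamma>"
      using successor_of_linkage[OF wf Z(2)] by blast
    let ?A = "?V - Z1"
    let ?B = "s ` ?A" and ?g = "inv_into ?A s"
    have A: "?A \<subseteq> ?V - Z" using Z1(2) by blast
    then have inj: "inj_on s ?A" using s(1) inj_on_subset by blast
    have img: "?g ` ?B = ?A" using inj by (simp add: inv_into_image_cancel)
    have "?B \<subseteq> ?V - W" using s(2) A by blast
    moreover have "?g y \<in> F y" if y: "y \<in> ?B" for y
    proof -
      obtain x where x: "x \<in> ?A" "y = s x" using y by blast
      then have "?g y = x" using inj by simp
      then show ?thesis using s(3)[of x] x A by (auto simp: F_def)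
    qed
    moreover have "inj_on ?g ?B" by (rule inj_on_inv_into) simp
    moreover have "?g ` ?B \<in> indeps (dual ?N)" unfolding img using basis_indep[OF cobasis[OF Z1(1)]] .
    ultimately have "?B \<in> indeps Q" unfolding indQ by blast
    moreover have "card ?B = card (?V - Z0)"
      using card_image[OF inj] card_bases_eq[OF matD cobasis[OF Z1(1)] cobasis[OF Z0]] by simp
    ultimately have "?B \<in> bases Q" using basQ by blast
    moreover have "W \<subseteq> ground Q - ?B"
      using W \<open>?B \<subseteq> ?V - W\<close> by (auto simp: Q_def bipartite_induction_def)
    ultimately show "W \<in> indeps (dual Q)" unfolding indeps_dual by blast
  next
    assume "W \<in> indeps (dual Q)"
    then obtain B where B: "B \<in> bases Q" "W \<subseteq> ?V - B"
      unfolding indeps_dual by (auto simp: Q_def bipartite_induction_def)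
    then obtain g where g: "inj_on g B" "\<forall>y\<in>B. g y \<in> F y" "g ` B \<in> indeps (dual ?N)"
      using basis_indep indQ by blast
    have "card (g ` B) = card (?V - Z0)" using B(1) basQ card_image[OF g(1)] by simp
    then have "g ` B \<in> bases (dual ?N)" using basis_iff_card[OF matD cobasis[OF Z0]] g(3) by blast
    then have gB: "g ` B \<subseteq> ?V" "?V - g ` B \<in> bases M" using basD by auto
    let ?Z = "?V - g ` B" and ?s = "inv_into B g"
    have dom: "?V - ?Z = g ` B" using gB(1) by blast
    have s1: "inj_on ?s (?V - ?Z)" unfolding dom by (rule inj_on_inv_into) simp
    have s2: "?s ` (?V - ?Z) \<subseteq> ?V - W"
    proof -
      have "?s ` (?V - ?Z) = B" unfolding dom using g(1) by (simp add: inv_into_image_cancel)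
      moreover have "B \<subseteq> ?V" using B(1) basis_indep indQ by blast
      ultimately show ?thesis using B(2) by blast
    qed
    have s3: "?s x = x \<or> (x, ?s x) \<in> parcs \<Gamma>" if x: "x \<in> ?V - ?Z" for x
    proof -
      obtain y where y: "y \<in> B" "x = g y" using x unfolding dom by blast
      then have "?s x = y" using g(1) by simp
      then show ?thesis using g(2) y by (auto simp: F_def)
    qed
    have "W \<subseteq> ?V" using B(2) by blast
    then obtain Z where Z: "Z \<subseteq> ?Z" "linked \<Gamma> W Z"
      using linkage_of_successor[OF finV _ s1 s2 s3] by blast
    have "Z \<in> indeps M" using indep_mono[OF matM basis_indep[OF gB(2)]] Z(1) by blast
    then show "W \<in> indeps (induced_matroid \<Gamma> M)"
      using B(2) Z(2) by (auto simp: induced_matroid_def)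
  qed
  then have "indeps (induced_matroid \<Gamma> M) = indeps (dual Q)" by blast
  moreover have "ground (induced_matroid \<Gamma> M) = ground (dual Q)"
    by (simp add: induced_matroid_def Q_def bipartite_induction_def)
  ultimately have "induced_matroid \<Gamma> M = dual Q" by (intro pre_matroid.equality) auto
  then show ?thesis using k_base_orderable_dual[OF Q k] by simp
qed

theorem theorem7p1:
  fixes k :: nat
  assumes "k \<ge> 1"
  shows "complete_class {M :: 'a pre_matroid. k_base_orderable k M} \<and>
         (\<forall>(M :: 'a pre_matroid) (N :: 'b pre_matroid).
            k_base_orderable k M \<and> matroid N \<and> isomorphic M N \<longrightarrow> k_base_orderable k N)"
proof -
  have "matroid_class {M :: 'a pre_matroid. k_base_orderable k M}"
    using k_base_orderable_matroid k_base_orderable_isomorphic unfolding matroid_class_def by blast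
  then have "complete_class {M :: 'a pre_matroid. k_base_orderable k M}"
    unfolding complete_class_def
    by (intro conjI ballI allI impI)
       (auto intro: assms k_base_orderable_minor k_base_orderable_dual k_base_orderable_direct_sum
          k_base_orderable_truncation k_base_orderable_induced_matroid)
  then show ?thesis using k_base_orderable_isomorphic by blast
qed

end
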